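(* Let $X$ be a finite ordered set, let $S(X)$ be the free Steiner loop with free generators $X$ and identity element $\emptyset$, and put $S(X)^{*}=S(X)\setminus\{\emptyset\}$. Let $G=\mathrm{Mult}(S(X))$ be the group of right multiplications of $S(X)$, i.e. the permutation group generated by the right translations $R_v:y\mapsto y\cdot v$, $v\in S(X)$. Then: 1. $G=\ast_{v\in S(X)^{*}}C_v$ is a free product of cyclic groups $C_v$ of order $2$. 2. $G$ acts on $S(X)$, and $G=\{R_v\mid v\in S(X)\}\,\mathrm{Stab}_G(\emptyset)$. Moreover, the inner mapping group $\mathrm{Stab}_G(\emptyset)$ is a free subgroup of $G$ generated by the elements $R_vR_wR_{vw}$, $v,w\in S(X)$, where $vw$ denotes the product of $v$ and $w$ in $S(X)$.
   Context: A Steiner loop is a commutative loop with identity $e$ satisfying $x\cdot x=e$ and $x\cdot(x\cdot y)=y$ for all $x,y$ (equivalently, a diassociative loop of exponent $2$). Steiner loops form a variety, and free objects are taken in this variety. The multiplication group of a loop is the permutation group generated by all its left and right translations (these coincide in the commutative case), and the inner mapping group is the stabilizer of the identity element in the multiplication group.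
   Formalization: The free product decomposition of G in item 1 is claimed only for |X| ≠ 2: for |X| = 2, S(X) is the Klein four-group, so G has order 4, while the free product of three groups of order 2 is infinite. All other claims cover every finite X. *)

theory Defs
  imports "HOL-Algebra.Group_Action" "HOL-Algebra.Elementary_Groups"
begin

section \<open>Monoids given by generators and relations\<close>

definition words :: "'a set \<Rightarrow> 'a list set" where
  "words A = {u. set u \<subseteq> A}"

lemma words_simps [simp]:
  "[] \<in> words A"
  "a # u \<in> words A \<longleftrightarrow> a \<in> A \<and> u \<in> words A"
  "u @ v \<in> words A \<longleftrightarrow> u \<in> words A \<and> v \<in> words A"
  by (auto simp: words_def)

text \<open>The least congruence on the free monoid \<^term>\<open>words A\<close> containing the relations \<^term>\<open>R\<close>.\<close>

inductive word_cong :: "'a set \<Rightarrow> ('a list \<times> 'a list) set \<Rightarrow> 'a list \<Rightarrow> 'a list \<Rightarrow> bool"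
  for A R where
  wc_rel: "(u, v) \<in> R \<Longrightarrow> u \<in> words A \<Longrightarrow> v \<in> words A \<Longrightarrow> p \<in> words A \<Longrightarrow> q \<in> words A
            \<Longrightarrow> word_cong A R (p @ u @ q) (p @ v @ q)"
| wc_refl: "u \<in> words A \<Longrightarrow> word_cong A R u u"
| wc_sym: "word_cong A R u v \<Longrightarrow> word_cong A R v u"
| wc_trans: "word_cong A R u v \<Longrightarrow> word_cong A R v w \<Longrightarrow> word_cong A R u w"

definition word_class :: "'a set \<Rightarrow> ('a list \<times> 'a list) set \<Rightarrow> 'a list \<Rightarrow> 'a list set" where
  "word_class A R u = {v. word_cong A R u v}"

definition presented_monoid :: "'a set \<Rightarrow> ('a list \<times> 'a list) set \<Rightarrow> 'a list set monoid" where
  "presented_monoid A R =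
     \<lparr>carrier = word_class A R ` words A,
      mult = (\<lambda>U V. \<Union>u\<in>U. \<Union>v\<in>V. word_class A R (u @ v)),
      one = word_class A R []\<rparr>"

lemma word_cong_words: "word_cong A R u v \<Longrightarrow> u \<in> words A \<and> v \<in> words A"
  by (induction rule: word_cong.induct) auto

lemma word_class_eq_iff:
  assumes "u \<in> words A"
  shows "word_class A R u = word_class A R v \<longleftrightarrow> word_cong A R u v"
  using assms unfolding word_class_def
  by (auto intro: word_cong.intros)

lemma word_cong_append_left:
  "word_cong A R u v \<Longrightarrow> w \<in> words A \<Longrightarrow> word_cong A R (w @ u) (w @ v)"
proof (induction rule: word_cong.induct)
  case (wc_rel u v p q)
  then have "word_cong A R ((w @ p) @ u @ q) ((w @ p) @ v @ q)"
    by (intro word_cong.wc_rel) auto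
  then show ?case by simp
qed (auto intro: word_cong.intros)

lemma word_cong_append_right:
  "word_cong A R u v \<Longrightarrow> w \<in> words A \<Longrightarrow> word_cong A R (u @ w) (v @ w)"
proof (induction rule: word_cong.induct)
  case (wc_rel u v p q)
  then have "word_cong A R (p @ u @ (q @ w)) (p @ v @ (q @ w))"
    by (intro word_cong.wc_rel) auto
  then show ?case by simp
qed (auto intro: word_cong.intros)

lemma word_cong_append:
  assumes "word_cong A R u u'" "word_cong A R v v'"
  shows "word_cong A R (u @ v) (u' @ v')"
  using word_cong_append_left[OF assms(2), of u] word_cong_append_right[OF assms(1), of v']
    word_cong_words[OF assms(1)] word_cong_words[OF assms(2)]
  by (blast intro: wc_trans)

lemma presented_monoid_mult:
  assumes "u \<in> words A" "v \<in> words A"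
  shows "word_class A R u \<otimes>\<^bsub>presented_monoid A R\<^esub> word_class A R v = word_class A R (u @ v)"
proof -
  have "word_class A R (u' @ v') = word_class A R (u @ v)"
    if "u' \<in> word_class A R u" "v' \<in> word_class A R v" for u' v'
  proof -
    have "word_cong A R (u @ v) (u' @ v')"
      using that by (intro word_cong_append) (simp_all add: word_class_def)
    then have "word_class A R (u @ v) = word_class A R (u' @ v')"
      using assms by (subst word_class_eq_iff) auto
    then show ?thesis by simp
  qed
  moreover have "u \<in> word_class A R u" "v \<in> word_class A R v"
    using assms by (auto simp: word_class_def intro: wc_refl)
  ultimately have "(\<Union>u'\<in>word_class A R u. \<Union>v'\<in>word_class A R v. word_class A R (u' @ v'))
      = word_class A R (u @ v)"
    by blast
  then show ?thesis by (simp add: presented_monoid_def)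
qed

lemma presented_monoid_carrier: "carrier (presented_monoid A R) = word_class A R ` words A"
  by (simp add: presented_monoid_def)

lemma presented_monoid_one: "\<one>\<^bsub>presented_monoid A R\<^esub> = word_class A R []"
  by (simp add: presented_monoid_def)

lemma monoid_presented_monoid: "monoid (presented_monoid A R)"
proof (rule monoidI)
  fix x y
  assume "x \<in> carrier (presented_monoid A R)" "y \<in> carrier (presented_monoid A R)"
  then show "x \<otimes>\<^bsub>presented_monoid A R\<^esub> y \<in> carrier (presented_monoid A R)"
    by (auto simp: presented_monoid_carrier presented_monoid_mult)
next
  show "\<one>\<^bsub>presented_monoid A R\<^esub> \<in> carrier (presented_monoid A R)"
    by (auto simp: presented_monoid_carrier presented_monoid_one)
next
  fix x y z
  assume "x \<in> carrier (presented_monoid A R)" "y \<in> carrier (presented_monoid A R)"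
    "z \<in> carrier (presented_monoid A R)"
  then obtain u v w where "u \<in> words A" "v \<in> words A" "w \<in> words A"
    "x = word_class A R u" "y = word_class A R v" "z = word_class A R w"
    by (auto simp: presented_monoid_carrier)
  then show "x \<otimes>\<^bsub>presented_monoid A R\<^esub> y \<otimes>\<^bsub>presented_monoid A R\<^esub> z
      = x \<otimes>\<^bsub>presented_monoid A R\<^esub> (y \<otimes>\<^bsub>presented_monoid A R\<^esub> z)"
    by (simp add: presented_monoid_mult)
qed (auto simp: presented_monoid_carrier presented_monoid_one presented_monoid_mult)

lemma group_presented_monoid:
  assumes inv: "\<And>a. a \<in> A \<Longrightarrow> \<exists>b\<in>A. word_cong A R [b, a] []"
  shows "group (presented_monoid A R)"
proof -
  interpret monoid "presented_monoid A R" by (rule monoid_presented_monoid)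
  have "\<exists>v\<in>words A. word_cong A R (v @ u) []" if "u \<in> words A" for u
    using that
  proof (induction u)
    case Nil
    show ?case by (intro bexI[of _ "[]"]) (auto intro: wc_refl)
  next
    case (Cons a u)
    then obtain v where v: "v \<in> words A" "word_cong A R (v @ u) []" by auto
    have "a \<in> A" using Cons.prems by simp
    from inv[OF this] obtain b where b: "b \<in> A" "word_cong A R [b, a] []" by blast
    have "word_cong A R (v @ [b, a] @ u) (v @ [] @ u)"
      using v b Cons.prems by (intro word_cong_append_left word_cong_append_right) auto
    then have "word_cong A R (v @ [b, a] @ u) []"
      using v(2) by (auto intro: wc_trans)
    then have "word_cong A R ((v @ [b]) @ a # u) []"
      by simp
    with v b show ?case by (intro bexI[of _ "v @ [b]"]) auto
  qed
  then have left_inv: "\<exists>v\<in>words A. word_class A R (v @ u) = word_class A R []" if "u \<in> words A" for u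
    using that word_class_eq_iff[of "_ @ u" A R "[]"] by (metis words_simps(3))
  show ?thesis
  proof (rule groupI)
    fix x assume "x \<in> carrier (presented_monoid A R)"
    then obtain u where u: "u \<in> words A" "x = word_class A R u"
      by (auto simp: presented_monoid_carrier)
    with left_inv obtain v where "v \<in> words A" "word_class A R (v @ u) = word_class A R []"
      by blast
    then show "\<exists>y\<in>carrier (presented_monoid A R).
        y \<otimes>\<^bsub>presented_monoid A R\<^esub> x = \<one>\<^bsub>presented_monoid A R\<^esub>"
      using u by (intro bexI[of _ "word_class A R v"])
        (auto simp: presented_monoid_carrier presented_monoid_one presented_monoid_mult)
  qed (auto simp: m_assoc)
qed

lemma presented_monoid_universal:
  assumes "group K" and f: "f \<in> A \<rightarrow> carrier K"
    and R: "\<And>u v. (u, v) \<in> R \<Longrightarrow> u \<in> words A \<Longrightarrow> v \<in> words A \<Longrightarrow>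
              foldr (\<lambda>a k. f a \<otimes>\<^bsub>K\<^esub> k) u \<one>\<^bsub>K\<^esub> = foldr (\<lambda>a k. f a \<otimes>\<^bsub>K\<^esub> k) v \<one>\<^bsub>K\<^esub>"
  shows "\<exists>h \<in> hom (presented_monoid A R) K. \<forall>a\<in>A. h (word_class A R [a]) = f a"
proof -
  interpret K: group K by fact
  define e where "e u = foldr (\<lambda>a k. f a \<otimes>\<^bsub>K\<^esub> k) u \<one>\<^bsub>K\<^esub>" for u
  have e_closed: "e u \<in> carrier K" if "u \<in> words A" for u
    using that f by (induction u) (auto simp: e_def)
  have e_append: "e (u @ v) = e u \<otimes>\<^bsub>K\<^esub> e v" if "u \<in> words A" "v \<in> words A" for u v
    using that(1)
  proof (induction u)
    case Nil
    show ?case using e_closed[OF that(2)] by (simp add: e_def)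
  next
    case (Cons a u)
    then have "e ((a # u) @ v) = f a \<otimes>\<^bsub>K\<^esub> (e u \<otimes>\<^bsub>K\<^esub> e v)" by (simp add: e_def)
    also have "\<dots> = e (a # u) \<otimes>\<^bsub>K\<^esub> e v"
      using Cons f that(2) e_closed by (subst K.m_assoc[symmetric]) (auto simp: e_def)
    finally show ?case .
  qed
  have e_cong: "e u = e v" if "word_cong A R u v" for u v
    using that
  proof (induction rule: word_cong.induct)
    case (wc_rel u v p q)
    have "e u = e v" using R wc_rel unfolding e_def by blast
    then show ?case using wc_rel by (simp add: e_append)
  qed auto
  define h where "h U = e (SOME u. u \<in> U)" for U
  have h: "h (word_class A R u) = e u" if "u \<in> words A" for u
  proof -
    have "u \<in> word_class A R u" using that by (auto simp: word_class_def intro: wc_refl)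
    then have "(SOME v. v \<in> word_class A R u) \<in> word_class A R u" by (rule someI)
    then show ?thesis unfolding h_def by (auto simp: word_class_def dest: e_cong)
  qed
  have "h \<in> hom (presented_monoid A R) K"
    by (auto simp: hom_def presented_monoid_carrier presented_monoid_mult h e_closed e_append)
  moreover have "\<forall>a\<in>A. h (word_class A R [a]) = f a"
    using f by (auto simp: h e_def Pi_iff)
  ultimately show ?thesis by blast
qed

section \<open>Free products of groups\<close>

text \<open>Letters are pairs of an index \<open>i\<close> and an element of the \<open>i\<close>-th factor.\<close>

definition free_product_letters :: "'i set \<Rightarrow> ('i \<Rightarrow> ('g, 'm) monoid_scheme) \<Rightarrow> ('i \<times> 'g) set" where
  "free_product_letters I H = (SIGMA i:I. carrier (H i))"

definition free_product_relators ::
    "'i set \<Rightarrow> ('i \<Rightarrow> ('g, 'm) monoid_scheme) \<Rightarrow> (('i \<times> 'g) list \<times> ('i \<times> 'g) list) set" where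
  "free_product_relators I H =
     {([(i, \<one>\<^bsub>H i\<^esub>)], []) | i. i \<in> I} \<union>
     {([(i, g), (i, h)], [(i, g \<otimes>\<^bsub>H i\<^esub> h)]) | i g h. i \<in> I \<and> g \<in> carrier (H i) \<and> h \<in> carrier (H i)}"

definition free_product ::
    "'i set \<Rightarrow> ('i \<Rightarrow> ('g, 'm) monoid_scheme) \<Rightarrow> ('i \<times> 'g) list set monoid" where
  "free_product I H = presented_monoid (free_product_letters I H) (free_product_relators I H)"

definition free_product_inj ::
    "'i set \<Rightarrow> ('i \<Rightarrow> ('g, 'm) monoid_scheme) \<Rightarrow> 'i \<Rightarrow> 'g \<Rightarrow> ('i \<times> 'g) list set" where
  "free_product_inj I H i g = word_class (free_product_letters I H) (free_product_relators I H) [(i, g)]"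

text \<open>\<open>G\<close> is the (internal) free product of its subgroups \<open>H i\<close>, \<open>i \<in> I\<close>: the inclusions
  \<open>H i \<subseteq> G\<close> induce an isomorphism from the free product onto \<open>G\<close>.\<close>

definition is_free_product_of ::
    "('g, 'm) monoid_scheme \<Rightarrow> 'i set \<Rightarrow> ('i \<Rightarrow> 'g set) \<Rightarrow> bool" where
  "is_free_product_of G I H \<longleftrightarrow>
     (\<forall>i\<in>I. subgroup (H i) G) \<and>
     (\<exists>\<phi> \<in> iso (free_product I (\<lambda>i. G\<lparr>carrier := H i\<rparr>)) G.
        \<forall>i\<in>I. \<forall>h\<in>H i. \<phi> (free_product_inj I (\<lambda>i. G\<lparr>carrier := H i\<rparr>) i h) = h)"

lemma group_free_product:
  assumes "\<And>i. i \<in> I \<Longrightarrow> group (H i)"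
  shows "group (free_product I H)"
  unfolding free_product_def
proof (rule group_presented_monoid)
  let ?A = "free_product_letters I H" and ?R = "free_product_relators I H"
  fix a assume "a \<in> ?A"
  then obtain i g where a: "a = (i, g)" "i \<in> I" "g \<in> carrier (H i)"
    by (auto simp: free_product_letters_def)
  interpret group "H i" using a assms by simp
  let ?b = "(i, inv\<^bsub>H i\<^esub> g)"
  have "([?b, a], [(i, \<one>\<^bsub>H i\<^esub>)]) \<in> ?R"
    unfolding free_product_relators_def using a l_inv[OF a(3), symmetric] inv_closed[OF a(3)]
    by (intro UnI2) (simp only: mem_Collect_eq, blast)
  moreover have "?b \<in> ?A" "(i, \<one>\<^bsub>H i\<^esub>) \<in> ?A"
    using a by (auto simp: free_product_letters_def)
  ultimately have "word_cong ?A ?R ([] @ [?b, a] @ []) ([] @ [(i, \<one>\<^bsub>H i\<^esub>)] @ [])"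
    using \<open>a \<in> ?A\<close> by (intro wc_rel) auto
  moreover have "word_cong ?A ?R ([] @ [(i, \<one>\<^bsub>H i\<^esub>)] @ []) ([] @ [] @ [])"
    using \<open>(i, \<one>\<^bsub>H i\<^esub>) \<in> ?A\<close> a by (intro wc_rel) (auto simp: free_product_relators_def)
  ultimately show "\<exists>b\<in>?A. word_cong ?A ?R [b, a] []"
    using \<open>?b \<in> ?A\<close> by (auto intro: wc_trans)
qed

lemma free_product_universal:
  assumes H: "\<And>i. i \<in> I \<Longrightarrow> group (H i)" and "group K"
    and f: "\<And>i. i \<in> I \<Longrightarrow> f i \<in> hom (H i) K"
  shows "\<exists>h \<in> hom (free_product I H) K.
           \<forall>i\<in>I. \<forall>g\<in>carrier (H i). h (free_product_inj I H i g) = f i g"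
proof -
  interpret K: group K by fact
  have closed: "f i g \<in> carrier K" if "i \<in> I" "g \<in> carrier (H i)" for i g
    using f[OF that(1)] that(2) by (auto simp: hom_def)
  have one: "f i \<one>\<^bsub>H i\<^esub> = \<one>\<^bsub>K\<^esub>" if "i \<in> I" for i
    using hom_one[OF f H K.is_group] that by blast
  have "\<exists>h \<in> hom (presented_monoid (free_product_letters I H) (free_product_relators I H)) K.
     \<forall>a\<in>free_product_letters I H.
       h (word_class (free_product_letters I H) (free_product_relators I H) [a]) = case_prod f a"
    using \<open>group K\<close>
  proof (rule presented_monoid_universal)
    fix u v assume "(u, v) \<in> free_product_relators I H"
    then show "foldr (\<lambda>a k. case_prod f a \<otimes>\<^bsub>K\<^esub> k) u \<one>\<^bsub>K\<^esub> = foldr (\<lambda>a k. case_prod f a \<otimes>\<^bsub>K\<^esub> k) v \<one>\<^bsub>K\<^esub>"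
      using closed by (auto simp: free_product_relators_def one hom_mult[OF f]
          monoid.m_closed[OF group.is_monoid[OF H]])
  qed (auto simp: free_product_letters_def closed)
  then show ?thesis
    unfolding free_product_def free_product_inj_def
    by (auto simp: free_product_letters_def)
qed

section \<open>Free groups\<close>

text \<open>The letters \<open>(b, True)\<close> and \<open>(b, False)\<close> stand for \<open>b\<close> and its formal inverse.\<close>

definition free_group_relators :: "'b set \<Rightarrow> (('b \<times> bool) list \<times> ('b \<times> bool) list) set" where
  "free_group_relators B = {([(b, s), (b, \<not> s)], []) | b s. b \<in> B}"

definition free_group :: "'b set \<Rightarrow> ('b \<times> bool) list set monoid" where
  "free_group B = presented_monoid (B \<times> UNIV) (free_group_relators B)"

definition free_group_inj :: "'b set \<Rightarrow> 'b \<Rightarrow> ('b \<times> bool) list set" where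
  "free_group_inj B b = word_class (B \<times> UNIV) (free_group_relators B) [(b, True)]"

definition is_free_basis :: "('g, 'm) monoid_scheme \<Rightarrow> 'g set \<Rightarrow> bool" where
  "is_free_basis F B \<longleftrightarrow>
     B \<subseteq> carrier F \<and> (\<exists>\<phi> \<in> iso (free_group B) F. \<forall>b\<in>B. \<phi> (free_group_inj B b) = b)"

definition is_free_group :: "('g, 'm) monoid_scheme \<Rightarrow> bool" where
  "is_free_group F \<longleftrightarrow> group F \<and> (\<exists>B. is_free_basis F B)"

lemma group_free_group: "group (free_group B)"
  unfolding free_group_def
proof (rule group_presented_monoid)
  fix a assume "a \<in> B \<times> (UNIV :: bool set)"
  then obtain b s where a: "a = (b, s)" "b \<in> B" by auto
  have "([(b, \<not> s), (b, \<not> \<not> s)], []) \<in> free_group_relators B"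
    unfolding free_group_relators_def using a by blast
  then have "word_cong (B \<times> UNIV) (free_group_relators B)
      ([] @ [(b, \<not> s), (b, \<not> \<not> s)] @ []) ([] @ [] @ [])"
    using a by (intro wc_rel) auto
  then show "\<exists>c\<in>B \<times> UNIV. word_cong (B \<times> UNIV) (free_group_relators B) [c, a] []"
    using a by (intro bexI[of _ "(b, \<not> s)"]) auto
qed

lemma free_group_universal:
  assumes "group K" and f: "f \<in> B \<rightarrow> carrier K"
  shows "\<exists>h \<in> hom (free_group B) K. \<forall>b\<in>B. h (free_group_inj B b) = f b"
proof -
  interpret K: group K by fact
  define f' where "f' = (\<lambda>(b, s). if s then f b else inv\<^bsub>K\<^esub> (f b))"
  have "\<exists>h \<in> hom (presented_monoid (B \<times> UNIV) (free_group_relators B)) K.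
     \<forall>a\<in>B \<times> UNIV. h (word_class (B \<times> UNIV) (free_group_relators B) [a]) = f' a"
    using \<open>group K\<close>
  proof (rule presented_monoid_universal)
    show "f' \<in> B \<times> UNIV \<rightarrow> carrier K" using f by (auto simp: f'_def Pi_iff)
    fix u v assume "(u, v) \<in> free_group_relators B"
    then obtain b s where b: "b \<in> B" "u = [(b, s), (b, \<not> s)]" "v = []"
      by (auto simp: free_group_relators_def)
    moreover have "f b \<in> carrier K" using b f by auto
    ultimately show "foldr (\<lambda>a k. f' a \<otimes>\<^bsub>K\<^esub> k) u \<one>\<^bsub>K\<^esub> = foldr (\<lambda>a k. f' a \<otimes>\<^bsub>K\<^esub> k) v \<one>\<^bsub>K\<^esub>"
      by (cases s) (auto simp: f'_def)
  qed
  then obtain h where "h \<in> hom (free_group B) K"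
    "\<forall>a\<in>B \<times> UNIV. h (word_class (B \<times> UNIV) (free_group_relators B) [a]) = f' a"
    unfolding free_group_def by blast
  then show ?thesis
    unfolding free_group_inj_def by (intro bexI[of _ h]) (auto simp: f'_def)
qed

section \<open>Steiner loops\<close>

locale loop =
  fixes L (structure)
  assumes m_closed [intro, simp]: "x \<in> carrier L \<Longrightarrow> y \<in> carrier L \<Longrightarrow> x \<otimes> y \<in> carrier L"
    and one_closed [intro, simp]: "\<one> \<in> carrier L"
    and l_one [simp]: "x \<in> carrier L \<Longrightarrow> \<one> \<otimes> x = x"
    and r_one [simp]: "x \<in> carrier L \<Longrightarrow> x \<otimes> \<one> = x"
    and l_div: "a \<in> carrier L \<Longrightarrow> b \<in> carrier L \<Longrightarrow> \<exists>!x. x \<in> carrier L \<and> a \<otimes> x = b"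
    and r_div: "a \<in> carrier L \<Longrightarrow> b \<in> carrier L \<Longrightarrow> \<exists>!x. x \<in> carrier L \<and> x \<otimes> a = b"

locale steiner_loop = loop +
  assumes m_comm: "x \<in> carrier L \<Longrightarrow> y \<in> carrier L \<Longrightarrow> x \<otimes> y = y \<otimes> x"
    and m_self [simp]: "x \<in> carrier L \<Longrightarrow> x \<otimes> x = \<one>"
    and m_left_cancel [simp]: "x \<in> carrier L \<Longrightarrow> y \<in> carrier L \<Longrightarrow> x \<otimes> (x \<otimes> y) = y"

lemma steiner_loopI:
  fixes L (structure)
  assumes cl: "\<And>x y. x \<in> carrier L \<Longrightarrow> y \<in> carrier L \<Longrightarrow> x \<otimes> y \<in> carrier L"
    and one: "\<one> \<in> carrier L" "\<And>x. x \<in> carrier L \<Longrightarrow> \<one> \<otimes> x = x"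
    and comm: "\<And>x y. x \<in> carrier L \<Longrightarrow> y \<in> carrier L \<Longrightarrow> x \<otimes> y = y \<otimes> x"
    and self: "\<And>x. x \<in> carrier L \<Longrightarrow> x \<otimes> x = \<one>"
    and canc: "\<And>x y. x \<in> carrier L \<Longrightarrow> y \<in> carrier L \<Longrightarrow> x \<otimes> (x \<otimes> y) = y"
  shows "steiner_loop L"
proof
  fix a b assume ab: "a \<in> carrier L" "b \<in> carrier L"
  show "\<exists>!x. x \<in> carrier L \<and> a \<otimes> x = b" using ab by (metis cl canc)
  show "\<exists>!x. x \<in> carrier L \<and> x \<otimes> a = b" using ab by (metis cl canc comm)
qed (simp_all add: cl one self canc, metis one comm, metis comm)

text \<open>The free Steiner loop on \<open>X\<close> is the free algebra of the variety: terms over \<open>X\<close> modulo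
  the identities of Steiner loops.\<close>

datatype 'a loop_term = LUnit | LGen 'a | LMult "'a loop_term" "'a loop_term"

inductive steiner_eq :: "'a loop_term \<Rightarrow> 'a loop_term \<Rightarrow> bool" where
  se_refl: "steiner_eq s s"
| se_sym: "steiner_eq s t \<Longrightarrow> steiner_eq t s"
| se_trans: "steiner_eq s t \<Longrightarrow> steiner_eq t u \<Longrightarrow> steiner_eq s u"
| se_prod: "steiner_eq s s' \<Longrightarrow> steiner_eq t t' \<Longrightarrow> steiner_eq (LMult s t) (LMult s' t')"
| se_unit: "steiner_eq (LMult LUnit s) s"
| se_comm: "steiner_eq (LMult s t) (LMult t s)"
| se_self: "steiner_eq (LMult s s) LUnit"
| se_cancel: "steiner_eq (LMult s (LMult s t)) t"

definition loop_terms :: "'a set \<Rightarrow> 'a loop_term set" where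
  "loop_terms X = {t. set_loop_term t \<subseteq> X}"

definition steiner_class :: "'a set \<Rightarrow> 'a loop_term \<Rightarrow> 'a loop_term set" where
  "steiner_class X s = {t \<in> loop_terms X. steiner_eq s t}"

definition free_steiner_loop :: "'a set \<Rightarrow> 'a loop_term set monoid" where
  "free_steiner_loop X =
     \<lparr>carrier = steiner_class X ` loop_terms X,
      mult = (\<lambda>S T. \<Union>s\<in>S. \<Union>t\<in>T. steiner_class X (LMult s t)),
      one = steiner_class X LUnit\<rparr>"

lemma steiner_class_eq_iff:
  assumes "s \<in> loop_terms X" "t \<in> loop_terms X"
  shows "steiner_class X s = steiner_class X t \<longleftrightarrow> steiner_eq s t"
  using assms unfolding steiner_class_def by (auto intro: steiner_eq.intros)

lemma loop_terms_simps [simp]: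
  "LUnit \<in> loop_terms X" "LGen x \<in> loop_terms X \<longleftrightarrow> x \<in> X"
  "LMult s t \<in> loop_terms X \<longleftrightarrow> s \<in> loop_terms X \<and> t \<in> loop_terms X"
  by (auto simp: loop_terms_def)

lemma free_steiner_loop_carrier: "carrier (free_steiner_loop X) = steiner_class X ` loop_terms X"
  by (simp add: free_steiner_loop_def)

lemma free_steiner_loop_one: "\<one>\<^bsub>free_steiner_loop X\<^esub> = steiner_class X LUnit"
  by (simp add: free_steiner_loop_def)

lemma free_steiner_loop_mult:
  assumes "s \<in> loop_terms X" "t \<in> loop_terms X"
  shows "steiner_class X s \<otimes>\<^bsub>free_steiner_loop X\<^esub> steiner_class X t = steiner_class X (LMult s t)"
proof -
  have "steiner_class X (LMult s' t') = steiner_class X (LMult s t)"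
    if "s' \<in> steiner_class X s" "t' \<in> steiner_class X t" for s' t'
    using that assms by (subst steiner_class_eq_iff)
      (auto simp: steiner_class_def intro: se_prod se_sym)
  moreover have "s \<in> steiner_class X s" "t \<in> steiner_class X t"
    using assms by (auto simp: steiner_class_def intro: se_refl)
  ultimately have "(\<Union>s'\<in>steiner_class X s. \<Union>t'\<in>steiner_class X t. steiner_class X (LMult s' t'))
      = steiner_class X (LMult s t)"
    by blast
  then show ?thesis by (simp add: free_steiner_loop_def)
qed

lemma steiner_loop_free_steiner_loop: "steiner_loop (free_steiner_loop X)"
proof (rule steiner_loopI)
qed (unfold free_steiner_loop_carrier free_steiner_loop_one; (elim imageE)?;
    simp add: free_steiner_loop_mult steiner_class_eq_iff steiner_eq.intros)+

lemma free_steiner_loop_universal: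
  assumes "steiner_loop M" and f: "f \<in> X \<rightarrow> carrier M"
  shows "\<exists>h \<in> hom (free_steiner_loop X) M. \<forall>x\<in>X. h (steiner_class X (LGen x)) = f x"
proof -
  interpret M: steiner_loop M by fact
  define e where "e = rec_loop_term \<one>\<^bsub>M\<^esub> (\<lambda>x. if x \<in> X then f x else \<one>\<^bsub>M\<^esub>) (\<lambda>_ _ a b. a \<otimes>\<^bsub>M\<^esub> b)"
  have e_simps: "e LUnit = \<one>\<^bsub>M\<^esub>" "e (LGen x) = (if x \<in> X then f x else \<one>\<^bsub>M\<^esub>)"
    "e (LMult s t) = e s \<otimes>\<^bsub>M\<^esub> e t" for x s t by (auto simp: e_def)
  have e_closed: "e t \<in> carrier M" for t
    using f by (induction t) (auto simp: e_simps)
  have e_eq: "e s = e t" if "steiner_eq s t" for s t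
    using that by induction (auto simp: e_simps e_closed intro: M.m_comm)
  define h where "h U = e (SOME u. u \<in> U)" for U
  have h: "h (steiner_class X s) = e s" if "s \<in> loop_terms X" for s
  proof -
    have "s \<in> steiner_class X s" using that by (auto simp: steiner_class_def intro: se_refl)
    then have "(SOME t. t \<in> steiner_class X s) \<in> steiner_class X s" by (rule someI)
    then show ?thesis unfolding h_def by (auto simp: steiner_class_def dest: e_eq)
  qed
  have "h \<in> hom (free_steiner_loop X) M"
    by (auto simp: hom_def free_steiner_loop_carrier free_steiner_loop_mult h e_closed e_simps)
  moreover have "\<forall>x\<in>X. h (steiner_class X (LGen x)) = f x"
    by (auto simp: h e_simps)
  ultimately show ?thesis by blast
qed

lemma free_steiner_loop_universal_unique:
  assumes "steiner_loop M"
    and h: "h \<in> hom (free_steiner_loop X) M" and k: "k \<in> hom (free_steiner_loop X) M"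
    and gen: "\<And>x. x \<in> X \<Longrightarrow> h (steiner_class X (LGen x)) = k (steiner_class X (LGen x))"
    and "U \<in> carrier (free_steiner_loop X)"
  shows "h U = k U"
proof -
  interpret M: steiner_loop M by fact
  interpret S: steiner_loop "free_steiner_loop X" by (rule steiner_loop_free_steiner_loop)
  have unit: "l \<one>\<^bsub>free_steiner_loop X\<^esub> = \<one>\<^bsub>M\<^esub>" if "l \<in> hom (free_steiner_loop X) M" for l
    using that hom_mult[OF that, of "\<one>\<^bsub>free_steiner_loop X\<^esub>" "\<one>\<^bsub>free_steiner_loop X\<^esub>"]
      hom_in_carrier[OF that S.one_closed] by (metis M.m_self S.l_one S.one_closed)
  have "h (steiner_class X t) = k (steiner_class X t)" if "t \<in> loop_terms X" for t
    using that
  proof (induction t)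
    case LUnit
    then show ?case using unit[OF h] unit[OF k] by (simp add: free_steiner_loop_one)
  next
    case (LGen x)
    then show ?case using gen by simp
  next
    case (LMult s t)
    then show ?case
      using hom_mult[OF h, of "steiner_class X s" "steiner_class X t"]
        hom_mult[OF k, of "steiner_class X s" "steiner_class X t"]
      by (simp add: free_steiner_loop_carrier free_steiner_loop_mult)
  qed
  with \<open>U \<in> carrier (free_steiner_loop X)\<close> show ?thesis
    by (auto simp: free_steiner_loop_carrier)
qed

section \<open>Multiplication groups\<close>

definition right_translation :: "('a, 'm) monoid_scheme \<Rightarrow> 'a \<Rightarrow> 'a \<Rightarrow> 'a" where
  "right_translation L v = (\<lambda>y\<in>carrier L. y \<otimes>\<^bsub>L\<^esub> v)"

text \<open>The product of \<^const>\<open>BijGroup\<close> is composition of maps, so permutations act from the left.\<close>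

definition mult_group :: "('a, 'm) monoid_scheme \<Rightarrow> ('a \<Rightarrow> 'a) monoid" where
  "mult_group L = subgroup_generated (BijGroup (carrier L)) (right_translation L ` carrier L)"

text \<open>\<^const>\<open>subgroup_generated\<close> silently intersects its second argument with the carrier; this loses
  nothing here.\<close>

lemma (in loop) right_translation_in_Bij:
  assumes "v \<in> carrier L"
  shows "right_translation L v \<in> carrier (BijGroup (carrier L))"
proof -
  have "bij_betw (right_translation L v) (carrier L) (carrier L)"
    unfolding bij_betw_def inj_on_def right_translation_def image_def using assms r_div
    by (auto; metis m_closed)
  then show ?thesis by (simp add: BijGroup_def Bij_def right_translation_def)
qed

definition inner_mapping_group :: "('a, 'm) monoid_scheme \<Rightarrow> ('a \<Rightarrow> 'a) set" where
  "inner_mapping_group L = stabilizer (mult_group L) (\<lambda>g. g) \<one>\<^bsub>L\<^esub>"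

end

theory Submission
  imports Defs
begin

text \<open>The idea is to exploit a length on the free Steiner loop. Terms have normal forms, and the number
  of multiplications in a normal form is a length for which, in every triple \<open>v, w, v w\<close> of distinct
  nontrivial elements, one element is strictly longer than the two others; moreover an element is in
  at most one way the product of two shorter ones. Hence a sufficiently long element keeps growing
  under a word in the translations without repeated neighbours, so that no such word is trivial and
  the multiplication group is the free product of the groups generated by the translations. Long
  elements exist as soon as there are three generators; with at most one generator there are no such
  words of length two, and with two generators the inner mapping group is trivial.

  The group acts simply transitively on pairs of a loop element and an inner mapping. The nontrivial
  elements \<open>R v R w R (v w)\<close> come in pairs of distinct inverses, and choosing one of each pair gives a basis:
  being a free product of groups of order two, the multiplication group also acts on the pairs of a
  loop element and an element of the free group on the basis. Reading off the second coordinate on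
  the inner mapping group inverts the canonical map from the free group.\<close>

section \<open>Free products and free groups\<close>

lemma word_class_in_carrier:
  "u \<in> words A \<Longrightarrow> word_class A R u \<in> carrier (presented_monoid A R)"
  by (simp add: presented_monoid_carrier)

lemma hom_word_class:
  assumes "group K" "h \<in> hom (presented_monoid A R) K" "group (presented_monoid A R)" "u \<in> words A"
  shows "h (word_class A R u) = foldr (\<lambda>a k. h (word_class A R [a]) \<otimes>\<^bsub>K\<^esub> k) u \<one>\<^bsub>K\<^esub>"
  using assms(4)
proof (induction u)
  case Nil
  then show ?case
    using hom_one[OF assms(2,3,1)] by (simp add: presented_monoid_one)
next
  case (Cons a u)
  have "word_class A R (a # u) = word_class A R [a] \<otimes>\<^bsub>presented_monoid A R\<^esub> word_class A R u"
    using Cons.prems by (simp add: presented_monoid_mult)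
  then show ?case
    using Cons by (simp add: hom_mult[OF assms(2)] word_class_in_carrier)
qed

section \<open>Reduced words in free products\<close>

definition reduced_free_product_words ::
    "'i set \<Rightarrow> ('i \<Rightarrow> ('g, 'm) monoid_scheme) \<Rightarrow> ('i \<times> 'g) list set" where
  "reduced_free_product_words I H =
     {u \<in> words (free_product_letters I H). distinct_adj (map fst u) \<and> (\<forall>(i, g)\<in>set u. g \<noteq> \<one>\<^bsub>H i\<^esub>)}"

text \<open>Induction on the word. A letter put in front of a reduced word is dropped if it is a
  unit, kept if the next letter lies in another factor, and otherwise merged with that letter. If
  the merged letter is a unit, the rest of the word remains, which is reduced as well.\<close>

lemma ex_reduced_free_product_word:
  fixes I :: "'i set" and H :: "'i \<Rightarrow> ('g, 'm) monoid_scheme"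
  assumes H: "\<And>i. i \<in> I \<Longrightarrow> group (H i)" and "u \<in> words (free_product_letters I H)"
  shows "\<exists>w \<in> reduced_free_product_words I H.
    word_cong (free_product_letters I H) (free_product_relators I H) u w"
  using assms(2)
proof (induction u)
  case Nil
  then show ?case
    by (intro bexI[of _ "[]"]) (auto simp: reduced_free_product_words_def intro: wc_refl)
next
  case (Cons a u)
  let ?A = "free_product_letters I H" and ?R = "free_product_relators I H"
  obtain i g where a: "a = (i, g)" "i \<in> I" "g \<in> carrier (H i)"
    using Cons.prems by (auto simp: free_product_letters_def)
  interpret Hi: group "H i" using a H by blast
  obtain w where w: "w \<in> reduced_free_product_words I H" "word_cong ?A ?R u w"
    using Cons by auto
  have wA: "w \<in> words ?A" using w by (simp add: reduced_free_product_words_def)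
  have aA: "a \<in> ?A" using Cons.prems by simp
  have cong: "word_cong ?A ?R (a # u) (a # w)"
    using word_cong_append_left[OF w(2), of "[a]"] aA by simp
  have unit: "word_cong ?A ?R ((i, \<one>\<^bsub>H i\<^esub>) # v) v" if "v \<in> words ?A" for v
    using wc_rel[of "[(i, \<one>\<^bsub>H i\<^esub>)]" "[]" ?R ?A "[]" v] a that
    by (auto simp: free_product_relators_def free_product_letters_def)
  have comb: "word_cong ?A ?R ((i, g) # (i, h) # v) ((i, g \<otimes>\<^bsub>H i\<^esub> h) # v)"
    if "v \<in> words ?A" "h \<in> carrier (H i)" for h v
    using wc_rel[of "[(i, g), (i, h)]" "[(i, g \<otimes>\<^bsub>H i\<^esub> h)]" ?R ?A "[]" v] a that
    by (auto simp: free_product_relators_def free_product_letters_def)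
  have *: "\<exists>w' \<in> reduced_free_product_words I H. word_cong ?A ?R (a # w) w'"
  proof (cases "g = \<one>\<^bsub>H i\<^esub>")
    case True
    then show ?thesis using unit[OF wA] w a by auto
  next
    case g: False
    show ?thesis
    proof (cases "w \<noteq> [] \<and> fst (hd w) = i")
      case False
      then have "a # w \<in> reduced_free_product_words I H"
        using w aA a g by (cases w) (auto simp: reduced_free_product_words_def)
      then show ?thesis using aA wA by (intro bexI[of _ "a # w"]) (auto intro: wc_refl)
    next
      case True
      then obtain h v where v: "w = (i, h) # v" by (cases w) auto
      then have h: "h \<in> carrier (H i)" and vA: "v \<in> words ?A"
        and vr: "v \<in> reduced_free_product_words I H"
        using w wA by (auto simp: reduced_free_product_words_def free_product_letters_def
            distinct_adj_Cons)
      show ?thesis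
      proof (cases "g \<otimes>\<^bsub>H i\<^esub> h = \<one>\<^bsub>H i\<^esub>")
        case True
        then show ?thesis using comb[OF vA h] unit[OF vA] vr v a by (intro bexI[of _ v]) (auto intro: wc_trans)
      next
        case False
        then have "(i, g \<otimes>\<^bsub>H i\<^esub> h) # v \<in> reduced_free_product_words I H"
          using w v h a by (auto simp: reduced_free_product_words_def free_product_letters_def
              distinct_adj_Cons)
        then show ?thesis using comb[OF vA h] v a by (intro bexI[of _ "(i, g \<otimes>\<^bsub>H i\<^esub> h) # v"]) auto
      qed
    qed
  qed
  then show ?case using wc_trans[OF cong] by blast
qed

text \<open>The canonical map from the free product is surjective because the factors generate. Its
  kernel is trivial because every class contains a reduced word, and by \<open>red\<close> a
  nonempty reduced word has a nontrivial value.\<close>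

lemma (in group) is_free_product_ofI:
  assumes H: "\<And>i. i \<in> I \<Longrightarrow> subgroup (H i) G"
    and gen: "carrier G \<subseteq> generate G (\<Union>i\<in>I. H i)"
    and red: "\<And>u. u \<noteq> [] \<Longrightarrow> u \<in> reduced_free_product_words I (\<lambda>i. G\<lparr>carrier := H i\<rparr>) \<Longrightarrow>
      foldr (\<lambda>a k. snd a \<otimes> k) u \<one> \<noteq> \<one>"
  shows "is_free_product_of G I H"
proof -
  let ?H = "\<lambda>i. G\<lparr>carrier := H i\<rparr>"
  let ?A = "free_product_letters I ?H" and ?R = "free_product_relators I ?H"
  let ?P = "free_product I ?H"
  have Hg: "group (?H i)" if "i \<in> I" for i using subgroup_imp_group[OF H[OF that]] .
  interpret P: group ?P by (rule group_free_product[OF Hg])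
  have incl: "(\<lambda>g. g) \<in> hom (?H i) G" if "i \<in> I" for i
    using subgroup.subset[OF H[OF that]] by (auto simp: hom_def)
  have "\<exists>h \<in> hom ?P G. \<forall>i\<in>I. \<forall>g\<in>carrier (?H i). h (free_product_inj I ?H i g) = g"
    by (rule free_product_universal[OF Hg is_group incl])
  then obtain \<phi> where \<phi>: "\<phi> \<in> hom ?P G"
    "\<And>i h. i \<in> I \<Longrightarrow> h \<in> H i \<Longrightarrow> \<phi> (free_product_inj I ?H i h) = h"
    by auto
  interpret \<phi>: group_hom ?P G \<phi> using \<phi> by unfold_locales
  have val: "\<phi> (word_class ?A ?R u) = foldr (\<lambda>a k. snd a \<otimes> k) u \<one>" if u: "u \<in> words ?A" for u
  proof -
    have "\<phi> (word_class ?A ?R u) = foldr (\<lambda>a k. \<phi> (word_class ?A ?R [a]) \<otimes> k) u \<one>"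
      using \<phi>(1) P.is_group is_group u unfolding free_product_def
      by (intro hom_word_class) auto
    also have "\<dots> = foldr (\<lambda>a k. snd a \<otimes> k) u \<one>"
      using u \<phi>(2) by (intro foldr_cong)
        (auto simp: words_def free_product_letters_def free_product_inj_def)
    finally show ?thesis .
  qed
  have "x = \<one>\<^bsub>?P\<^esub>" if x: "x \<in> carrier ?P" "\<phi> x = \<one>" for x
  proof -
    obtain u where u: "u \<in> words ?A" "x = word_class ?A ?R u"
      using x by (auto simp: free_product_def presented_monoid_carrier)
    obtain w where w: "w \<in> reduced_free_product_words I ?H" "word_cong ?A ?R u w"
      using ex_reduced_free_product_word[OF Hg u(1)] by blast
    have xw: "x = word_class ?A ?R w" using u(2) w(2) word_class_eq_iff[OF u(1), of ?R w] by simp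
    have "w = []"
      using red[OF _ w(1)] val[of w] x xw w(1) by (auto simp: reduced_free_product_words_def)
    then show ?thesis using xw by (simp add: free_product_def presented_monoid_one)
  qed
  then have "inj_on \<phi> (carrier ?P)"
    by (intro \<phi>.trivial_ker_imp_inj) (auto simp: kernel_def)
  moreover have "(\<Union>i\<in>I. H i) \<subseteq> \<phi> ` carrier ?P"
  proof clarify
    fix i h assume "i \<in> I" "h \<in> H i"
    moreover from this have "free_product_inj I ?H i h \<in> carrier ?P"
      by (auto simp: free_product_def free_product_inj_def free_product_letters_def
          intro!: word_class_in_carrier)
    ultimately show "h \<in> \<phi> ` carrier ?P" using \<phi>(2) by force
  qed
  then have "carrier G \<subseteq> \<phi> ` carrier ?P"
    using gen generate_subgroup_incl[OF _ \<phi>.img_is_subgroup] by blast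
  ultimately have "\<phi> \<in> iso ?P G"
    using \<phi>(1) \<phi>.hom_closed by (auto simp: iso_def bij_betw_def)
  then show ?thesis unfolding is_free_product_of_def using H \<phi>(2) by (auto intro: bexI[of _ \<phi>])
qed

text \<open>The universal property of the formal free product, carried over to \<open>G\<close>
  along the inverse of the isomorphism \<open>\<phi>\<close>.\<close>

lemma (in group) free_product_of_extend:
  assumes "is_free_product_of G I H" and K: "group K"
    and f: "\<And>i. i \<in> I \<Longrightarrow> f i \<in> hom (G\<lparr>carrier := H i\<rparr>) K"
  shows "\<exists>h \<in> hom G K. \<forall>i\<in>I. \<forall>g\<in>H i. h g = f i g"
proof -
  let ?H = "\<lambda>i. G\<lparr>carrier := H i\<rparr>"
  let ?P = "free_product I ?H"
  have Hs: "subgroup (H i) G" if "i \<in> I" for i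
    using assms(1) that by (auto simp: is_free_product_of_def)
  have Hg: "group (?H i)" if "i \<in> I" for i using subgroup_imp_group[OF Hs[OF that]] .
  interpret P: group ?P by (rule group_free_product[OF Hg])
  obtain \<phi> where \<phi>: "\<phi> \<in> iso ?P G" "\<And>i h. i \<in> I \<Longrightarrow> h \<in> H i \<Longrightarrow> \<phi> (free_product_inj I ?H i h) = h"
    using assms(1) by (auto simp: is_free_product_of_def)
  have "\<exists>h \<in> hom ?P K. \<forall>i\<in>I. \<forall>g\<in>carrier (?H i). h (free_product_inj I ?H i g) = f i g"
    by (rule free_product_universal[OF Hg K f])
  then obtain k where k: "k \<in> hom ?P K"
    "\<And>i g. i \<in> I \<Longrightarrow> g \<in> H i \<Longrightarrow> k (free_product_inj I ?H i g) = f i g"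
    by auto
  let ?\<psi> = "inv_into (carrier ?P) \<phi>"
  have \<psi>: "?\<psi> \<in> hom G ?P" using P.iso_set_sym[OF \<phi>(1)] by (auto simp: iso_def)
  have "k (?\<psi> g) = f i g" if "i \<in> I" "g \<in> H i" for i g
  proof -
    have "free_product_inj I ?H i g \<in> carrier ?P"
      using that by (auto simp: free_product_def free_product_inj_def free_product_letters_def
          intro!: word_class_in_carrier)
    then have "?\<psi> g = free_product_inj I ?H i g"
      using \<phi>(1) inv_into_f_f[of \<phi> "carrier ?P" "free_product_inj I ?H i g"] \<phi>(2)[OF that]
      by (simp add: iso_def bij_betw_def)
    then show ?thesis using k that by simp
  qed
  moreover have "k \<circ> ?\<psi> \<in> hom G K" using \<psi> k(1) by (auto simp: hom_def Pi_iff)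
  ultimately show ?thesis by (intro bexI[of _ "k \<circ> ?\<psi>"]) auto
qed

section \<open>Homomorphisms out of free groups\<close>

lemma free_group_inj_closed: "b \<in> B \<Longrightarrow> free_group_inj B b \<in> carrier (free_group B)"
  by (auto simp: free_group_def free_group_inj_def intro!: word_class_in_carrier)

text \<open>The letter \<open>(b, False)\<close> represents the inverse of
  \<open>free_group_inj B b\<close>, so agreement on \<open>B\<close> passes to all letters and from
  there to all words.\<close>

lemma free_group_hom_unique:
  assumes K: "group K" and h: "h \<in> hom (free_group B) K" and k: "k \<in> hom (free_group B) K"
    and eq: "\<And>b. b \<in> B \<Longrightarrow> h (free_group_inj B b) = k (free_group_inj B b)"
    and x: "x \<in> carrier (free_group B)"
  shows "h x = k x"
proof -
  interpret F: group "free_group B" by (rule group_free_group)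
  interpret K: group K by fact
  interpret h: group_hom "free_group B" K h using h by unfold_locales
  interpret k: group_hom "free_group B" K k using k by unfold_locales
  let ?c = "word_class (B \<times> UNIV) (free_group_relators B)"
  have inv: "?c [(b, False)] = inv\<^bsub>free_group B\<^esub> (free_group_inj B b)" if "b \<in> B" for b
  proof (rule F.inv_equality[symmetric])
    have "word_cong (B \<times> UNIV) (free_group_relators B)
        ([] @ [(b, False), (b, \<not> False)] @ []) ([] @ [] @ [])"
      using that by (intro wc_rel) (auto simp: free_group_relators_def)
    then show "?c [(b, False)] \<otimes>\<^bsub>free_group B\<^esub> free_group_inj B b = \<one>\<^bsub>free_group B\<^esub>"
      using that by (auto simp: free_group_def free_group_inj_def presented_monoid_mult
          presented_monoid_one word_class_eq_iff)
  qed (use that in \<open>auto simp: free_group_def free_group_inj_def intro!: word_class_in_carrier\<close>)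
  have letter: "h (?c [a]) = k (?c [a])" if "a \<in> B \<times> UNIV" for a
  proof -
    define b s where "b = fst a" and "s = snd a"
    then have a: "a = (b, s)" "b \<in> B" using that by auto
    show ?thesis
    proof (cases s)
      case True
      then show ?thesis using a eq by (simp add: free_group_inj_def)
    next
      case False
      then show ?thesis using a eq inv free_group_inj_closed[OF a(2)] by simp
    qed
  qed
  obtain u where u: "u \<in> words (B \<times> UNIV)" "x = ?c u"
    using x by (auto simp: free_group_def presented_monoid_carrier)
  have "h (?c u) = foldr (\<lambda>a k'. h (?c [a]) \<otimes>\<^bsub>K\<^esub> k') u \<one>\<^bsub>K\<^esub>"
    using h K F.is_group u unfolding free_group_def by (intro hom_word_class) auto
  also have "\<dots> = foldr (\<lambda>a k'. k (?c [a]) \<otimes>\<^bsub>K\<^esub> k') u \<one>\<^bsub>K\<^esub>"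
    using u letter by (intro foldr_cong) (auto simp: words_def)
  also have "\<dots> = k (?c u)"
    using k K F.is_group u unfolding free_group_def by (intro hom_word_class[symmetric]) auto
  finally show ?thesis using u by simp
qed

section \<open>The multiplication group of a Steiner loop\<close>

lemma BijGroup_mult_apply:
  "g \<in> carrier (BijGroup E) \<Longrightarrow> h \<in> carrier (BijGroup E) \<Longrightarrow> x \<in> E \<Longrightarrow>
    (g \<otimes>\<^bsub>BijGroup E\<^esub> h) x = g (h x)"
  by (simp add: BijGroup_def compose_def)

lemma BijGroup_one_apply: "x \<in> E \<Longrightarrow> \<one>\<^bsub>BijGroup E\<^esub> x = x"
  by (simp add: BijGroup_def)

lemma BijGroup_apply_closed: "g \<in> carrier (BijGroup E) \<Longrightarrow> x \<in> E \<Longrightarrow> g x \<in> E"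
  using Bij_imp_funcset by (fastforce simp: BijGroup_def)

lemma BijGroup_eqI:
  assumes "g \<in> carrier (BijGroup E)" "h \<in> carrier (BijGroup E)" "\<And>x. x \<in> E \<Longrightarrow> g x = h x"
  shows "g = h"
  using assms by (auto simp: BijGroup_def Bij_def intro: extensionalityI)

sublocale loop \<subseteq> mult: group "mult_group L"
  unfolding mult_group_def by (intro group.group_subgroup_generated group_BijGroup)

context loop
begin

abbreviation "M \<equiv> mult_group L"
abbreviation "R \<equiv> right_translation L"

lemma mult_group_subset: "carrier M \<subseteq> carrier (BijGroup (carrier L))"
  unfolding mult_group_def by (intro group.carrier_subgroup_generated_subset group_BijGroup)

lemma mult_apply:
  "g \<in> carrier M \<Longrightarrow> h \<in> carrier M \<Longrightarrow> y \<in> carrier L \<Longrightarrow> (g \<otimes>\<^bsub>M\<^esub> h) y = g (h y)"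
  using mult_group_subset by (auto simp: mult_group_def intro!: BijGroup_mult_apply)

lemma mult_one_apply: "y \<in> carrier L \<Longrightarrow> \<one>\<^bsub>M\<^esub> y = y"
  by (simp add: mult_group_def BijGroup_one_apply)

lemma mult_apply_closed: "g \<in> carrier M \<Longrightarrow> y \<in> carrier L \<Longrightarrow> g y \<in> carrier L"
  using mult_group_subset by (auto intro: BijGroup_apply_closed)

lemma mult_eqI:
  "g \<in> carrier M \<Longrightarrow> h \<in> carrier M \<Longrightarrow> (\<And>y. y \<in> carrier L \<Longrightarrow> g y = h y) \<Longrightarrow> g = h"
  using mult_group_subset by (blast intro: BijGroup_eqI)

lemma translation_closed: "v \<in> carrier L \<Longrightarrow> R v \<in> carrier M"
  unfolding mult_group_def
  using right_translation_in_Bij by (auto simp: carrier_subgroup_generated intro: generate.incl)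

lemma translation_apply: "y \<in> carrier L \<Longrightarrow> R v y = y \<otimes> v"
  by (simp add: right_translation_def)

text \<open>Generation is restated inside \<open>M\<close> instead of the full symmetric group, so
  that later inductions over \<open>generate\<close> never leave \<open>M\<close>.\<close>

lemma mult_group_generated: "carrier M = generate M (R ` carrier L)"
proof -
  interpret B: group "BijGroup (carrier L)" by (rule group_BijGroup)
  have "carrier (subgroup_generated M (R ` carrier L)) = carrier M"
    by (simp add: mult_group_def)
  moreover have "carrier M \<inter> R ` carrier L = R ` carrier L"
    using translation_closed by auto
  ultimately show ?thesis by (simp add: carrier_subgroup_generated)
qed

lemma translation_one: "R \<one> = \<one>\<^bsub>M\<^esub>"
  by (rule mult_eqI) (simp_all add: translation_closed translation_apply mult_one_apply)

lemma group_action_mult: "group_action M (carrier L) (\<lambda>g. g)"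
proof -
  interpret B: group "BijGroup (carrier L)" by (rule group_BijGroup)
  have "(\<lambda>g. g) \<in> hom M (BijGroup (carrier L))"
    using mult_group_subset by (auto simp: hom_def mult_group_def)
  then show ?thesis by unfold_locales
qed

lemma inner_mapping_group_iff: "g \<in> inner_mapping_group L \<longleftrightarrow> g \<in> carrier M \<and> g \<one> = \<one>"
  by (simp add: inner_mapping_group_def stabilizer_def)

lemma subgroup_inner_mapping_group: "subgroup (inner_mapping_group L) M"
  unfolding inner_mapping_group_def
  using group_action.stabilizer_subgroup[OF group_action_mult one_closed] .

section \<open>Generators of the inner mapping group\<close>

definition inner_gen :: "'a \<Rightarrow> 'a \<Rightarrow> 'a \<Rightarrow> 'a" where
  "inner_gen v w = R v \<otimes>\<^bsub>M\<^esub> R w \<otimes>\<^bsub>M\<^esub> R (v \<otimes> w)"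

definition inner_gens :: "('a \<Rightarrow> 'a) set" where
  "inner_gens = {inner_gen v w | v w. v \<in> carrier L \<and> w \<in> carrier L}"

lemma inner_gen_closed: "v \<in> carrier L \<Longrightarrow> w \<in> carrier L \<Longrightarrow> inner_gen v w \<in> carrier M"
  by (simp add: inner_gen_def translation_closed)

lemma inner_gen_in_gens: "v \<in> carrier L \<Longrightarrow> w \<in> carrier L \<Longrightarrow> inner_gen v w \<in> inner_gens"
  by (auto simp: inner_gens_def)

lemma inner_gens_subset: "inner_gens \<subseteq> carrier M"
  by (auto simp: inner_gens_def inner_gen_closed)

lemma inner_gen_apply:
  "v \<in> carrier L \<Longrightarrow> w \<in> carrier L \<Longrightarrow> y \<in> carrier L \<Longrightarrow>
    inner_gen v w y = ((y \<otimes> (v \<otimes> w)) \<otimes> w) \<otimes> v"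
  by (simp add: inner_gen_def translation_closed mult_apply translation_apply)

end

context steiner_loop
begin

lemma m_right_cancel [simp]: "x \<in> carrier L \<Longrightarrow> y \<in> carrier L \<Longrightarrow> y \<otimes> x \<otimes> x = y"
  using m_left_cancel[of x y] m_comm[of x y] m_comm[of x "x \<otimes> y"] by simp

lemma m_right_cancel' [simp]: "x \<in> carrier L \<Longrightarrow> y \<in> carrier L \<Longrightarrow> x \<otimes> (y \<otimes> x) = y"
  using m_left_cancel[of x y] m_comm[of x y] by simp

lemma m_left_cancel' [simp]: "x \<in> carrier L \<Longrightarrow> y \<in> carrier L \<Longrightarrow> x \<otimes> y \<otimes> x = y"
  using m_right_cancel[of x y] m_comm[of x y] by simp

lemma m_eq_one_iff: "x \<in> carrier L \<Longrightarrow> y \<in> carrier L \<Longrightarrow> x \<otimes> y = \<one> \<longleftrightarrow> x = y"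
  using m_left_cancel[of x y] by (auto simp del: m_left_cancel)

lemma m_eq_left_iff: "x \<in> carrier L \<Longrightarrow> y \<in> carrier L \<Longrightarrow> x \<otimes> y = x \<longleftrightarrow> y = \<one>"
  using m_left_cancel[of x y] by (auto simp del: m_left_cancel)

lemma m_eq_right_iff: "x \<in> carrier L \<Longrightarrow> y \<in> carrier L \<Longrightarrow> x \<otimes> y = y \<longleftrightarrow> x = \<one>"
  using m_eq_left_iff[of y x] m_comm[of x y] by simp

lemma translation_self: "v \<in> carrier L \<Longrightarrow> R v \<otimes>\<^bsub>M\<^esub> R v = \<one>\<^bsub>M\<^esub>"
  by (rule mult_eqI) (simp_all add: translation_closed translation_apply mult_apply mult_one_apply)

lemma translation_inv: "v \<in> carrier L \<Longrightarrow> inv\<^bsub>M\<^esub> (R v) = R v"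
  by (rule mult.inv_equality) (simp_all add: translation_self translation_closed)

lemma translation_cancel:
  "v \<in> carrier L \<Longrightarrow> g \<in> carrier M \<Longrightarrow> R v \<otimes>\<^bsub>M\<^esub> (R v \<otimes>\<^bsub>M\<^esub> g) = g"
  by (simp add: translation_closed translation_self mult.m_assoc[symmetric])

lemma inner_gen_one_left: "v \<in> carrier L \<Longrightarrow> inner_gen \<one> v = \<one>\<^bsub>M\<^esub>"
  by (simp add: inner_gen_def translation_one translation_self translation_closed)

lemma inner_gen_one_right: "v \<in> carrier L \<Longrightarrow> inner_gen v \<one> = \<one>\<^bsub>M\<^esub>"
  by (simp add: inner_gen_def translation_one translation_self translation_closed)

lemma inner_gen_self: "v \<in> carrier L \<Longrightarrow> inner_gen v v = \<one>\<^bsub>M\<^esub>"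
  by (simp add: inner_gen_def translation_one translation_self translation_closed)

text \<open>Translations are involutions, so inversion reverses the three factors; since
  \<open>(v \<otimes> w) \<otimes> w = v\<close>, the reversed product is again of the same
  shape.\<close>

lemma inv_inner_gen:
  "v \<in> carrier L \<Longrightarrow> w \<in> carrier L \<Longrightarrow> inv\<^bsub>M\<^esub> (inner_gen v w) = inner_gen (v \<otimes> w) w"
  by (simp add: inner_gen_def mult.inv_mult_group translation_inv translation_closed mult.m_assoc)

text \<open>The rightmost factor acts first: the identity goes to \<open>v \<otimes> w\<close>, then
  to \<open>v\<close>, then back to the identity.\<close>

lemma inner_gens_inner: "inner_gens \<subseteq> inner_mapping_group L"
  by (auto simp: inner_gens_def inner_mapping_group_iff inner_gen_closed inner_gen_apply)

text \<open>The rewriting rule that collects two translations into a single one, at the cost of one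
  generator on the right.\<close>

lemma translation_mult_translation:
  assumes "v \<in> carrier L" "w \<in> carrier L"
  shows "R w \<otimes>\<^bsub>M\<^esub> R v = R (v \<otimes> w) \<otimes>\<^bsub>M\<^esub> inner_gen (v \<otimes> w) w"
  using assms by (simp add: inner_gen_def mult.m_assoc translation_closed translation_cancel)

text \<open>The set \<open>W\<close> of products of the desired form contains the identity and is
  closed under left multiplication by translations, hence by all of \<open>M\<close>.\<close>

lemma mult_group_decomp:
  assumes "g \<in> carrier M"
  shows "\<exists>v\<in>carrier L. \<exists>t\<in>generate M inner_gens. g = R v \<otimes>\<^bsub>M\<^esub> t"
proof -
  define W where "W = {R v \<otimes>\<^bsub>M\<^esub> t | v t. v \<in> carrier L \<and> t \<in> generate M inner_gens}"
  have tM: "t \<in> carrier M" if "t \<in> generate M inner_gens" for t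
    using mult.generate_in_carrier[OF inner_gens_subset that] .
  have step: "R w \<otimes>\<^bsub>M\<^esub> x \<in> W" if w: "w \<in> carrier L" and x: "x \<in> W" for w x
  proof -
    obtain v t where v: "v \<in> carrier L" "t \<in> generate M inner_gens" "x = R v \<otimes>\<^bsub>M\<^esub> t"
      using x by (auto simp: W_def)
    have "R w \<otimes>\<^bsub>M\<^esub> x = (R w \<otimes>\<^bsub>M\<^esub> R v) \<otimes>\<^bsub>M\<^esub> t"
      using v w tM by (simp add: mult.m_assoc translation_closed)
    also have "\<dots> = R (v \<otimes> w) \<otimes>\<^bsub>M\<^esub> (inner_gen (v \<otimes> w) w \<otimes>\<^bsub>M\<^esub> t)"
      using v w tM
      by (simp add: translation_mult_translation mult.m_assoc translation_closed inner_gen_closed)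
    moreover have "inner_gen (v \<otimes> w) w \<otimes>\<^bsub>M\<^esub> t \<in> generate M inner_gens"
      using v w by (intro generate.eng generate.incl[of "inner_gen (v \<otimes> w) w"] v) (auto simp: inner_gens_def)
    ultimately show ?thesis using v w unfolding W_def by auto
  qed
  have WM: "x \<in> carrier M" if "x \<in> W" for x
    using that tM by (auto simp: W_def translation_closed)
  \<comment> \<open>Quantifying over \<open>x\<close> in \<open>W\<close> makes the claim compose in
    the product case of the induction; \<open>x = \<one>\<close> gives the result.\<close>
  have "\<forall>x\<in>W. g \<otimes>\<^bsub>M\<^esub> x \<in> W"
    using assms[unfolded mult_group_generated]
  proof (induction rule: generate.induct)
    case one
    then show ?case by (simp add: WM)
  next
    case (incl h)
    then show ?case using step by auto
  next
    case (inv h)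
    then show ?case using step by (auto simp: translation_inv)
  next
    case (eng h1 h2)
    then have "h1 \<in> carrier M" "h2 \<in> carrier M" by (auto simp: mult_group_generated)
    with eng.IH show ?case by (auto simp: mult.m_assoc WM)
  qed
  moreover have "\<one>\<^bsub>M\<^esub> \<in> W"
    unfolding W_def mem_Collect_eq
    by (intro exI[of _ \<one>] exI[of _ "\<one>\<^bsub>M\<^esub>"]) (simp add: generate.one translation_one)
  ultimately have "g \<otimes>\<^bsub>M\<^esub> \<one>\<^bsub>M\<^esub> \<in> W" by blast
  then have "g \<in> W" using assms by simp
  then show ?thesis by (auto simp: W_def)
qed

text \<open>In a decomposition \<open>g = R v t\<close> the factor \<open>t\<close> fixes the
  identity, so \<open>v\<close> is the image of the identity under \<open>g\<close>. If
  \<open>g\<close> is inner, then \<open>v = \<one>\<close> and \<open>g = t\<close>.\<close>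

lemma inner_mapping_group_generated: "inner_mapping_group L = generate M inner_gens"
proof
  show sub: "generate M inner_gens \<subseteq> inner_mapping_group L"
    using mult.generate_subgroup_incl[OF inner_gens_inner subgroup_inner_mapping_group] .
  show "inner_mapping_group L \<subseteq> generate M inner_gens"
  proof
    fix g assume g: "g \<in> inner_mapping_group L"
    then obtain v t where v: "v \<in> carrier L" "t \<in> generate M inner_gens" "g = R v \<otimes>\<^bsub>M\<^esub> t"
      using mult_group_decomp[of g] by (auto simp: inner_mapping_group_iff)
    then have "t \<in> carrier M" "t \<one> = \<one>"
      using sub by (auto simp: inner_mapping_group_iff)
    then have "g \<one> = v" using v by (simp add: mult_apply translation_closed translation_apply)
    then have "v = \<one>" using g by (simp add: inner_mapping_group_iff)
    then show "g \<in> generate M inner_gens" using v \<open>t \<in> carrier M\<close> by (simp add: translation_one)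
  qed
qed

lemma mult_group_factorization:
  "carrier M = {R v | v. v \<in> carrier L} <#>\<^bsub>M\<^esub> inner_mapping_group L"
proof
  show "carrier M \<subseteq> {R v | v. v \<in> carrier L} <#>\<^bsub>M\<^esub> inner_mapping_group L"
    unfolding set_mult_def inner_mapping_group_generated using mult_group_decomp by blast
  show "{R v | v. v \<in> carrier L} <#>\<^bsub>M\<^esub> inner_mapping_group L \<subseteq> carrier M"
    by (auto simp: set_mult_def translation_closed inner_mapping_group_iff)
qed

lemma generate_translation:
  assumes "v \<in> carrier L"
  shows "generate M {R v} = {\<one>\<^bsub>M\<^esub>, R v}"
proof
  have "subgroup {\<one>\<^bsub>M\<^esub>, R v} M"
    using assms by (auto intro!: mult.subgroupI simp: translation_closed translation_inv translation_self)
  then show "generate M {R v} \<subseteq> {\<one>\<^bsub>M\<^esub>, R v}"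
    by (intro mult.generate_subgroup_incl) auto
qed (simp add: generate.one generate.incl)

lemma translation_eq_one_iff:
  assumes "v \<in> carrier L"
  shows "R v = \<one>\<^bsub>M\<^esub> \<longleftrightarrow> v = \<one>"
proof
  assume "R v = \<one>\<^bsub>M\<^esub>"
  then show "v = \<one>"
    using assms translation_apply[of \<one> v] mult_one_apply[of \<one>] by simp
qed (simp add: translation_one)

lemma translation_subgroup_order_two:
  assumes "v \<in> carrier L - {\<one>}"
  shows "cyclic_group (M\<lparr>carrier := generate M {R v}\<rparr>)"
    and "order (M\<lparr>carrier := generate M {R v}\<rparr>) = 2"
proof -
  have "subgroup_generated M {R v} = M\<lparr>carrier := generate M {R v}\<rparr>"
    using assms translation_closed by (simp add: subgroup_generated_def)
  then show "cyclic_group (M\<lparr>carrier := generate M {R v}\<rparr>)"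
    using mult.cyclic_group_generated[of "R v"] by simp
  show "order (M\<lparr>carrier := generate M {R v}\<rparr>) = 2"
    using assms translation_eq_one_iff[of v] by (auto simp: order_def generate_translation)
qed

end

section \<open>Freeness of the inner mapping group\<close>

lemma restrict_involution_BijGroup:
  assumes "f \<in> E \<rightarrow> E" "\<And>x. x \<in> E \<Longrightarrow> f (f x) = x"
  shows "restrict f E \<in> carrier (BijGroup E)"
    and "restrict f E \<otimes>\<^bsub>BijGroup E\<^esub> restrict f E = \<one>\<^bsub>BijGroup E\<^esub>"
proof -
  have "bij_betw f E E"
    using assms by (intro bij_betw_byWitness[where f' = f]) auto
  then show closed: "restrict f E \<in> carrier (BijGroup E)"
    by (simp add: BijGroup_def Bij_def)
  interpret B: group "BijGroup E" by (rule group_BijGroup)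
  show "restrict f E \<otimes>\<^bsub>BijGroup E\<^esub> restrict f E = \<one>\<^bsub>BijGroup E\<^esub>"
    using closed assms by (intro BijGroup_eqI) (auto simp: BijGroup_mult_apply BijGroup_one_apply)
qed

text \<open>The canonical map from the free group is surjective because \<open>B\<close> generates.
  Following it by \<open>\<theta>\<close> fixes the free generators, so by uniqueness
  \<open>\<theta>\<close> is a left inverse and the map is injective.\<close>

lemma (in group) is_free_groupI:
  assumes sub: "B \<subseteq> carrier G" and gen: "carrier G \<subseteq> generate G B"
    and \<theta>: "\<theta> \<in> hom G (free_group B)" "\<And>b. b \<in> B \<Longrightarrow> \<theta> b = free_group_inj B b"
  shows "is_free_group G"
proof -
  interpret F: group "free_group B" by (rule group_free_group)
  have "\<exists>h \<in> hom (free_group B) G. \<forall>b\<in>B. h (free_group_inj B b) = b"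
    using free_group_universal[OF is_group, of "\<lambda>b. b" B] sub by auto
  then obtain \<phi> where \<phi>: "\<phi> \<in> hom (free_group B) G" "\<And>b. b \<in> B \<Longrightarrow> \<phi> (free_group_inj B b) = b"
    by blast
  interpret \<phi>: group_hom "free_group B" G \<phi> using \<phi>(1) by unfold_locales
  have "\<theta> (\<phi> x) = x" if "x \<in> carrier (free_group B)" for x
  proof -
    have "(\<lambda>x. \<theta> (\<phi> x)) \<in> hom (free_group B) (free_group B)"
      using \<phi>(1) \<theta>(1) by (auto simp: hom_def Pi_iff)
    moreover have "(\<lambda>x. x) \<in> hom (free_group B) (free_group B)"
      by (auto simp: hom_def)
    ultimately show ?thesis
      using free_group_hom_unique[OF F.is_group, of "\<lambda>x. \<theta> (\<phi> x)" B "\<lambda>x. x" x] \<phi>(2) \<theta>(2) that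
      by simp
  qed
  then have "inj_on \<phi> (carrier (free_group B))" by (rule inj_on_inverseI)
  moreover have "B \<subseteq> \<phi> ` carrier (free_group B)"
    using \<phi>(2) free_group_inj_closed by force
  then have "carrier G \<subseteq> \<phi> ` carrier (free_group B)"
    using gen generate_subgroup_incl[OF _ \<phi>.img_is_subgroup] by blast
  ultimately have "\<phi> \<in> iso (free_group B) G"
    using \<phi>(1) \<phi>.hom_closed by (auto simp: iso_def bij_betw_def)
  then show ?thesis
    using sub \<phi>(2) is_group unfolding is_free_group_def is_free_basis_def by blast
qed

text \<open>The assumption is the normal form criterion for a free product of groups of order two:
  each factor has one nontrivial element, so a reduced word is a list of indices without equal
  neighbours. It fails on two distinct free generators \<open>x\<close> and \<open>y\<close>, where
  the word \<open>[x, y, x \<otimes> y]\<close> is trivial.\<close>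

locale translation_free_steiner_loop = steiner_loop +
  assumes translation_free:
    "vs \<noteq> [] \<Longrightarrow> set vs \<subseteq> carrier L - {\<one>} \<Longrightarrow> distinct_adj vs \<Longrightarrow>
      foldr (\<lambda>v k. right_translation L v \<otimes>\<^bsub>mult_group L\<^esub> k) vs \<one>\<^bsub>mult_group L\<^esub>
        \<noteq> \<one>\<^bsub>mult_group L\<^esub>"
begin

lemma is_free_product_mult_group:
  "is_free_product_of M (carrier L - {\<one>}) (\<lambda>v. generate M {R v})"
proof (rule mult.is_free_product_ofI)
  show "subgroup (generate M {R v}) M" if "v \<in> carrier L - {\<one>}" for v
    using that by (intro mult.generate_is_subgroup) (auto simp: translation_closed)
  let ?U = "\<Union>v\<in>carrier L - {\<one>}. generate M {R v}"
  have "?U \<subseteq> carrier M"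
    by (auto simp: generate_translation translation_closed)
  then have "subgroup (generate M ?U) M" by (rule mult.generate_is_subgroup)
  moreover have "R v \<in> generate M ?U" if "v \<in> carrier L" for v
  proof (cases "v = \<one>")
    case True
    then show ?thesis by (simp add: translation_one generate.one)
  next
    case False
    then have "R v \<in> ?U" using that by (auto simp: generate_translation)
    then show ?thesis by (rule generate.incl)
  qed
  ultimately show "carrier M \<subseteq> generate M ?U"
    unfolding mult_group_generated by (intro mult.generate_subgroup_incl) auto
next
  fix u
  let ?H = "\<lambda>v. M\<lparr>carrier := generate M {R v}\<rparr>"
  assume u: "u \<noteq> []" "u \<in> reduced_free_product_words (carrier L - {\<one>}) ?H"
  \<comment> \<open>The only nontrivial element of the factor with index \<open>v\<close> is
    \<open>R v\<close>, so a reduced word is determined by its indices.\<close>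
  have letter: "fst a \<in> carrier L - {\<one>} \<and> snd a = R (fst a)" if "a \<in> set u" for a
  proof -
    have "a \<in> (SIGMA v:carrier L - {\<one>}. generate M {R v})" "snd a \<noteq> \<one>\<^bsub>M\<^esub>"
      using u(2) that
      by (auto simp: reduced_free_product_words_def words_def free_product_letters_def)
    then show ?thesis by (auto simp: generate_translation)
  qed
  have "foldr (\<lambda>a k. snd a \<otimes>\<^bsub>M\<^esub> k) u \<one>\<^bsub>M\<^esub> = foldr (\<lambda>a k. R (fst a) \<otimes>\<^bsub>M\<^esub> k) u \<one>\<^bsub>M\<^esub>"
    using letter by (intro foldr_cong) auto
  also have "\<dots> = foldr (\<lambda>v k. R v \<otimes>\<^bsub>M\<^esub> k) (map fst u) \<one>\<^bsub>M\<^esub>"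
    by (simp add: foldr_map comp_def)
  finally have "foldr (\<lambda>a k. snd a \<otimes>\<^bsub>M\<^esub> k) u \<one>\<^bsub>M\<^esub>
      = foldr (\<lambda>v k. R v \<otimes>\<^bsub>M\<^esub> k) (map fst u) \<one>\<^bsub>M\<^esub>" .
  moreover have "foldr (\<lambda>v k. R v \<otimes>\<^bsub>M\<^esub> k) (map fst u) \<one>\<^bsub>M\<^esub> \<noteq> \<one>\<^bsub>M\<^esub>"
    using u letter by (intro translation_free) (auto simp: reduced_free_product_words_def)
  ultimately show "foldr (\<lambda>a k. snd a \<otimes>\<^bsub>M\<^esub> k) u \<one>\<^bsub>M\<^esub> \<noteq> \<one>\<^bsub>M\<^esub>" by simp
qed

text \<open>For factors of order two the universal property asks only for images that square to the
  identity.\<close>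

lemma mult_group_extend:
  assumes K: "group K" and \<rho>: "\<And>v. v \<in> carrier L \<Longrightarrow> \<rho> v \<in> carrier K" "\<rho> \<one> = \<one>\<^bsub>K\<^esub>"
    "\<And>v. v \<in> carrier L \<Longrightarrow> \<rho> v \<otimes>\<^bsub>K\<^esub> \<rho> v = \<one>\<^bsub>K\<^esub>"
  shows "\<exists>\<psi> \<in> hom M K. \<forall>v\<in>carrier L. \<psi> (R v) = \<rho> v"
proof -
  interpret K: group K by fact
  define f where "f v g = (if g = \<one>\<^bsub>M\<^esub> then \<one>\<^bsub>K\<^esub> else \<rho> v)" for v g
  have "f v \<in> hom (M\<lparr>carrier := generate M {R v}\<rparr>) K" if "v \<in> carrier L - {\<one>}" for v
    using that \<rho> by (auto simp: hom_def f_def generate_translation translation_closed translation_self)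
  then have "\<exists>\<psi> \<in> hom M K. \<forall>v\<in>carrier L - {\<one>}. \<forall>g\<in>generate M {R v}. \<psi> g = f v g"
    by (rule mult.free_product_of_extend[OF is_free_product_mult_group K])
  then obtain \<psi> where \<psi>: "\<psi> \<in> hom M K"
    "\<And>v g. v \<in> carrier L - {\<one>} \<Longrightarrow> g \<in> generate M {R v} \<Longrightarrow> \<psi> g = f v g"
    by blast
  have "\<psi> (R v) = \<rho> v" if v: "v \<in> carrier L" for v
  proof (cases "v = \<one>")
    case True
    then show ?thesis using hom_one[OF \<psi>(1) mult.is_group K] \<rho>(2) by (simp add: translation_one)
  next
    case False
    then show ?thesis
      using \<psi>(2)[of v "R v"] v by (simp add: generate.incl f_def translation_eq_one_iff)
  qed
  then show ?thesis using \<psi>(1) by blast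
qed

text \<open>If \<open>t\<close> were its own inverse, the word
  \<open>v, w, v \<otimes> w, v, w, v \<otimes> w\<close> for its square would be trivial, although
  nontriviality of \<open>t\<close> makes the three elements nontrivial and distinct.\<close>

lemma inner_gen_neq_inv:
  assumes "t \<in> inner_gens" "t \<noteq> \<one>\<^bsub>M\<^esub>"
  shows "inv\<^bsub>M\<^esub> t \<noteq> t"
proof
  assume inv: "inv\<^bsub>M\<^esub> t = t"
  obtain v w where vw: "v \<in> carrier L" "w \<in> carrier L" "t = inner_gen v w"
    using assms(1) by (auto simp: inner_gens_def)
  have ne: "v \<noteq> \<one>" "w \<noteq> \<one>" "v \<noteq> w"
    using assms(2) vw inner_gen_one_left inner_gen_one_right inner_gen_self by auto
  have "foldr (\<lambda>v k. R v \<otimes>\<^bsub>M\<^esub> k) [v, w, v \<otimes> w, v, w, v \<otimes> w] \<one>\<^bsub>M\<^esub> \<noteq> \<one>\<^bsub>M\<^esub>"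
    using vw ne m_eq_one_iff[of v w] m_eq_left_iff[of v w] m_eq_right_iff[of v w]
    by (intro translation_free) auto
  also have "foldr (\<lambda>v k. R v \<otimes>\<^bsub>M\<^esub> k) [v, w, v \<otimes> w, v, w, v \<otimes> w] \<one>\<^bsub>M\<^esub> = t \<otimes>\<^bsub>M\<^esub> t"
    using vw by (simp add: inner_gen_def mult.m_assoc translation_closed)
  also have "\<dots> = \<one>\<^bsub>M\<^esub>"
    using mult.r_inv[of t] inv assms(1) inner_gens_subset by auto
  finally show False by simp
qed

section \<open>A basis of the inner mapping group\<close>

lemma inv_inner_gens: "t \<in> inner_gens \<Longrightarrow> inv\<^bsub>M\<^esub> t \<in> inner_gens"
proof -
  assume "t \<in> inner_gens"
  then obtain v w where "v \<in> carrier L" "w \<in> carrier L" "t = inner_gen v w"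
    by (auto simp: inner_gens_def)
  then show ?thesis by (simp add: inv_inner_gen inner_gen_in_gens)
qed

text \<open>\<open>SOME\<close> is applied to an unordered pair, so a generator and its inverse are
  subject to the same choice and exactly one of them is selected.\<close>

definition inner_basis :: "('a \<Rightarrow> 'a) set" where
  "inner_basis = {t \<in> inner_gens - {\<one>\<^bsub>M\<^esub>}. (SOME u. u \<in> {t, inv\<^bsub>M\<^esub> t}) = t}"

lemma inner_basis_subset: "inner_basis \<subseteq> inner_gens"
  by (auto simp: inner_basis_def)

lemma inner_basis_inv_iff:
  assumes "t \<in> inner_gens" "t \<noteq> \<one>\<^bsub>M\<^esub>"
  shows "inv\<^bsub>M\<^esub> t \<in> inner_basis \<longleftrightarrow> t \<notin> inner_basis"
proof -
  have t: "t \<in> carrier M" using assms inner_gens_subset by auto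
  define c where "c = (SOME u. u \<in> {t, inv\<^bsub>M\<^esub> t})"
  have "c \<in> {t, inv\<^bsub>M\<^esub> t}" unfolding c_def by (rule someI[of _ t]) simp
  moreover have "t \<in> inner_basis \<longleftrightarrow> c = t"
    using assms by (simp add: inner_basis_def c_def)
  moreover have "inv\<^bsub>M\<^esub> t \<in> inner_basis \<longleftrightarrow> c = inv\<^bsub>M\<^esub> t"
  proof -
    have "(SOME u. u \<in> {inv\<^bsub>M\<^esub> t, inv\<^bsub>M\<^esub> (inv\<^bsub>M\<^esub> t)}) = c"
      unfolding c_def mult.inv_inv[OF t] by (simp only: insert_commute)
    then show ?thesis using assms inv_inner_gens t by (simp add: inner_basis_def)
  qed
  ultimately show ?thesis using inner_gen_neq_inv[OF assms] by auto
qed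

abbreviation "F \<equiv> free_group inner_basis"

text \<open>On \<open>inner_gens\<close> this is the value forced on any homomorphism to the free
  group that sends each basis element to its free generator.\<close>

definition basis_word :: "('a \<Rightarrow> 'a) \<Rightarrow> (('a \<Rightarrow> 'a) \<times> bool) list set" where
  "basis_word t = (if t = \<one>\<^bsub>M\<^esub> then \<one>\<^bsub>F\<^esub>
     else if t \<in> inner_basis then free_group_inj inner_basis t
     else inv\<^bsub>F\<^esub> (free_group_inj inner_basis (inv\<^bsub>M\<^esub> t)))"

interpretation F: group F by (rule group_free_group)

lemma basis_word_closed:
  assumes "t \<in> inner_gens"
  shows "basis_word t \<in> carrier F"
  using inner_basis_inv_iff[OF assms] by (auto simp: basis_word_def free_group_inj_closed)

lemma basis_word_inv:
  assumes "t \<in> inner_gens"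
  shows "basis_word t \<otimes>\<^bsub>F\<^esub> basis_word (inv\<^bsub>M\<^esub> t) = \<one>\<^bsub>F\<^esub>"
proof -
  have "t \<in> carrier M" using assms inner_gens_subset by auto
  then show ?thesis
    using inner_basis_inv_iff[OF assms] by (auto simp: basis_word_def free_group_inj_closed)
qed

lemma basis_word_basis: "t \<in> inner_basis \<Longrightarrow> basis_word t = free_group_inj inner_basis t"
  by (auto simp: basis_word_def inner_basis_def)

abbreviation "E \<equiv> carrier L \<times> carrier F"

text \<open>Writing \<open>g = R v t\<close> with \<open>t\<close> an inner mapping identifies the multiplication group with pairs
  \<open>(v, t)\<close>. The map below is left multiplication by \<open>R w\<close> in these coordinates, with the inner
  mapping replaced by an element of the free group.\<close>

definition lifted_translation ::
    "'a \<Rightarrow> 'a \<times> (('a \<Rightarrow> 'a) \<times> bool) list set \<Rightarrow> 'a \<times> (('a \<Rightarrow> 'a) \<times> bool) list set" where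
  "lifted_translation w =
     restrict (\<lambda>(v, f). (v \<otimes> w, basis_word (inner_gen (v \<otimes> w) w) \<otimes>\<^bsub>F\<^esub> f)) E"

text \<open>The two generators are inverse to each other by \<open>inv_inner_gen\<close>. This is
  what makes \<open>lifted_translation w\<close> an involution.\<close>

lemma basis_word_inner_gen_cancel:
  assumes "v \<in> carrier L" "w \<in> carrier L" "f \<in> carrier F"
  shows "basis_word (inner_gen v w) \<otimes>\<^bsub>F\<^esub> (basis_word (inner_gen (v \<otimes> w) w) \<otimes>\<^bsub>F\<^esub> f) = f"
  using assms basis_word_inv[of "inner_gen v w"]
  by (simp add: F.m_assoc[symmetric] basis_word_closed inner_gen_in_gens inv_inner_gen)

lemma lifted_translation:
  assumes w: "w \<in> carrier L"
  shows "lifted_translation w \<in> carrier (BijGroup E)"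
    and "lifted_translation w \<otimes>\<^bsub>BijGroup E\<^esub> lifted_translation w = \<one>\<^bsub>BijGroup E\<^esub>"
  unfolding lifted_translation_def using w
  by (auto intro!: restrict_involution_BijGroup
      simp: basis_word_closed inner_gen_in_gens basis_word_inner_gen_cancel)

lemma lifted_translation_apply:
  "v \<in> carrier L \<Longrightarrow> f \<in> carrier F \<Longrightarrow>
    lifted_translation w (v, f) = (v \<otimes> w, basis_word (inner_gen (v \<otimes> w) w) \<otimes>\<^bsub>F\<^esub> f)"
  by (simp add: lifted_translation_def)

lemma lifted_translation_one: "lifted_translation \<one> = \<one>\<^bsub>BijGroup E\<^esub>"
proof (rule BijGroup_eqI)
  interpret B: group "BijGroup E" by (rule group_BijGroup)
  show "\<one>\<^bsub>BijGroup E\<^esub> \<in> carrier (BijGroup E)" by simp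
  show "lifted_translation \<one> \<in> carrier (BijGroup E)" by (simp add: lifted_translation)
  show "lifted_translation \<one> x = \<one>\<^bsub>BijGroup E\<^esub> x" if "x \<in> E" for x
    using that
    by (auto simp: BijGroup_one_apply lifted_translation_apply inner_gen_one_right basis_word_def)
qed

text \<open>The lifted translations extend to an action \<open>\<psi>\<close> of \<open>M\<close> on
  the pairs. An inner mapping fixes the first coordinate \<open>\<one>\<close>, and its effect on
  the second is left multiplication by one element of the free group, which gives a
  homomorphism.\<close>

lemma ex_inner_hom:
  "\<exists>\<theta> \<in> hom (M\<lparr>carrier := inner_mapping_group L\<rparr>) F. \<forall>t\<in>inner_gens. \<theta> t = basis_word t"
proof -
  interpret B: group "BijGroup E" by (rule group_BijGroup)
  have "\<exists>\<psi> \<in> hom M (BijGroup E). \<forall>v\<in>carrier L. \<psi> (R v) = lifted_translation v"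
    by (rule mult_group_extend)
      (simp_all add: group_BijGroup lifted_translation lifted_translation_one)
  then obtain \<psi> where \<psi>: "\<psi> \<in> hom M (BijGroup E)"
    "\<And>v. v \<in> carrier L \<Longrightarrow> \<psi> (R v) = lifted_translation v"
    by blast
  interpret \<psi>: group_hom M "BijGroup E" \<psi> using \<psi>(1) by unfold_locales
  have comp: "\<psi> (g \<otimes>\<^bsub>M\<^esub> h) x = \<psi> g (\<psi> h x)" if "g \<in> carrier M" "h \<in> carrier M" "x \<in> E" for g h x
    using that by (simp add: BijGroup_mult_apply)
  have closed: "\<psi> g x \<in> E" if "g \<in> carrier M" "x \<in> E" for g x
    using that by (intro BijGroup_apply_closed[of "\<psi> g"]) simp_all
  \<comment> \<open>The action covers that of \<open>M\<close> on \<open>L\<close> and commutes with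
    right multiplication on the second coordinate; both hold for translations and pass to
    products.\<close>
  have equivariant: "\<forall>v\<in>carrier L. \<forall>f\<in>carrier F. \<forall>f'\<in>carrier F.
      \<psi> g (v, f \<otimes>\<^bsub>F\<^esub> f') = (g v, snd (\<psi> g (v, f)) \<otimes>\<^bsub>F\<^esub> f')" if "g \<in> carrier M" for g
    using that[unfolded mult_group_generated]
  proof (induction rule: generate.induct)
    case one
    then show ?case by (simp add: BijGroup_one_apply mult_one_apply)
  next
    case (incl h)
    then show ?case
      by (auto simp: \<psi>(2) lifted_translation_apply translation_apply F.m_assoc
          basis_word_closed inner_gen_in_gens)
  next
    case (inv h)
    then show ?case
      by (auto simp: \<psi>(2) lifted_translation_apply translation_apply F.m_assoc translation_inv
          basis_word_closed inner_gen_in_gens)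
  next
    case (eng g h)
    then have gh: "g \<in> carrier M" "h \<in> carrier M" by (auto simp: mult_group_generated)
    show ?case
    proof (intro ballI)
      fix v f f' assume vf: "v \<in> carrier L" "f \<in> carrier F" "f' \<in> carrier F"
      have "\<psi> h (v, f) = (h v, snd (\<psi> h (v, f)))"
        using eng.IH(2) vf F.one_closed by (metis F.r_one snd_conv)
      moreover have hvf: "h v \<in> carrier L" "snd (\<psi> h (v, f)) \<in> carrier F"
        using closed[of h "(v, f)"] gh vf by (auto simp: mult_apply_closed mem_Times_iff)
      ultimately have "\<psi> (g \<otimes>\<^bsub>M\<^esub> h) (v, f) = \<psi> g (h v, snd (\<psi> h (v, f)))"
        using comp gh vf by simp
      moreover have "\<psi> (g \<otimes>\<^bsub>M\<^esub> h) (v, f \<otimes>\<^bsub>F\<^esub> f') = \<psi> g (h v, snd (\<psi> h (v, f)) \<otimes>\<^bsub>F\<^esub> f')"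
        using comp gh vf eng.IH(2) by simp
      ultimately show "\<psi> (g \<otimes>\<^bsub>M\<^esub> h) (v, f \<otimes>\<^bsub>F\<^esub> f') =
          ((g \<otimes>\<^bsub>M\<^esub> h) v, snd (\<psi> (g \<otimes>\<^bsub>M\<^esub> h) (v, f)) \<otimes>\<^bsub>F\<^esub> f')"
        using eng.IH(1) vf hvf gh by (simp add: mult_apply)
    qed
  qed
  define \<theta> where "\<theta> g = snd (\<psi> g (\<one>, \<one>\<^bsub>F\<^esub>))" for g
  have \<theta>_closed: "\<theta> g \<in> carrier F" if "g \<in> carrier M" for g
    using closed[OF that, of "(\<one>, \<one>\<^bsub>F\<^esub>)"] by (auto simp: \<theta>_def mem_Times_iff)
  have val: "\<psi> g (\<one>, f) = (\<one>, \<theta> g \<otimes>\<^bsub>F\<^esub> f)" if "g \<in> inner_mapping_group L" "f \<in> carrier F" for g f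
  proof -
    have "\<psi> g (\<one>, \<one>\<^bsub>F\<^esub> \<otimes>\<^bsub>F\<^esub> f) = (g \<one>, snd (\<psi> g (\<one>, \<one>\<^bsub>F\<^esub>)) \<otimes>\<^bsub>F\<^esub> f)"
      using equivariant[of g] that one_closed F.one_closed
      unfolding inner_mapping_group_iff by blast
    then show ?thesis using that by (simp add: \<theta>_def inner_mapping_group_iff)
  qed
  have "\<theta> \<in> hom (M\<lparr>carrier := inner_mapping_group L\<rparr>) F"
  proof (rule homI)
    fix g h assume "g \<in> carrier (M\<lparr>carrier := inner_mapping_group L\<rparr>)"
      "h \<in> carrier (M\<lparr>carrier := inner_mapping_group L\<rparr>)"
    then have gh: "g \<in> inner_mapping_group L" "h \<in> inner_mapping_group L" by auto
    then have "g \<in> carrier M" "h \<in> carrier M" by (auto simp: inner_mapping_group_iff)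
    then have "\<psi> (g \<otimes>\<^bsub>M\<^esub> h) (\<one>, \<one>\<^bsub>F\<^esub>) = (\<one>, \<theta> g \<otimes>\<^bsub>F\<^esub> \<theta> h)"
      using val[OF gh(2), of "\<one>\<^bsub>F\<^esub>"] val[OF gh(1), of "\<theta> h"] \<theta>_closed by (simp add: comp del: \<psi>.hom_mult)
    then show "\<theta> (g \<otimes>\<^bsub>M\<lparr>carrier := inner_mapping_group L\<rparr>\<^esub> h) = \<theta> g \<otimes>\<^bsub>F\<^esub> \<theta> h"
      by (simp add: \<theta>_def[of "g \<otimes>\<^bsub>M\<^esub> h"])
  qed (auto simp: \<theta>_closed inner_mapping_group_iff)
  moreover have "\<theta> t = basis_word t" if t: "t \<in> inner_gens" for t
  proof -
    obtain v w where vw: "v \<in> carrier L" "w \<in> carrier L" "t = inner_gen v w"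
      using t by (auto simp: inner_gens_def)
    have [simp]: "basis_word \<one>\<^bsub>M\<^esub> = \<one>\<^bsub>F\<^esub>" by (simp add: basis_word_def)
    \<comment> \<open>The first coordinate runs through \<open>\<one>\<close>,
      \<open>v \<otimes> w\<close>, \<open>v\<close>, \<open>\<one>\<close>. The outer translations
      contribute the words of \<open>inner_gen (v \<otimes> w) (v \<otimes> w)\<close> and
      \<open>inner_gen \<one> v\<close>, both trivial; the middle one contributes that of
      \<open>inner_gen v w = t\<close>.\<close>
    have "\<psi> t (\<one>, \<one>\<^bsub>F\<^esub>) =
        lifted_translation v (lifted_translation w (lifted_translation (v \<otimes> w) (\<one>, \<one>\<^bsub>F\<^esub>)))"
      using vw closed[of "R (v \<otimes> w)" "(\<one>, \<one>\<^bsub>F\<^esub>)"] closed[of "R w"]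
      by (simp add: inner_gen_def comp translation_closed \<psi>(2)[symmetric] mult.m_assoc
          del: \<psi>.hom_mult)
    also have "\<dots> = (\<one>, basis_word t)"
      using vw t basis_word_closed
      by (simp add: lifted_translation_apply inner_gen_self inner_gen_one_left)
    finally show ?thesis by (simp add: \<theta>_def)
  qed
  ultimately show ?thesis by blast
qed

lemma is_free_group_inner_mapping_group:
  "is_free_group (M\<lparr>carrier := inner_mapping_group L\<rparr>)"
proof -
  interpret I: group "M\<lparr>carrier := inner_mapping_group L\<rparr>"
    by (rule mult.subgroup_imp_group[OF subgroup_inner_mapping_group])
  have B: "inner_basis \<subseteq> inner_mapping_group L"
    using inner_basis_subset inner_gens_inner by blast
  then have BM: "inner_basis \<subseteq> carrier M"
    by (auto simp: inner_mapping_group_iff)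
  \<comment> \<open>A generator is trivial, a basis element, or the inverse of one, so passing to
    the basis keeps the generated subgroup.\<close>
  have "t \<in> generate M inner_basis" if t: "t \<in> inner_gens" for t
  proof -
    have tM: "t \<in> carrier M" using t inner_gens_subset by blast
    consider "t = \<one>\<^bsub>M\<^esub>" | "t \<in> inner_basis" | "inv\<^bsub>M\<^esub> t \<in> inner_basis"
      using inner_basis_inv_iff[OF t] by blast
    then show ?thesis
    proof cases
      case 3
      then show ?thesis using generate.inv[OF 3, of M] tM by simp
    qed (simp_all add: generate.one generate.incl)
  qed
  then have "generate M inner_gens \<subseteq> generate M inner_basis"
    using mult.generate_is_subgroup[OF BM] by (intro mult.generate_subgroup_incl) auto
  then have "carrier (M\<lparr>carrier := inner_mapping_group L\<rparr>)
      \<subseteq> generate (M\<lparr>carrier := inner_mapping_group L\<rparr>) inner_basis"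
    unfolding mult.generate_consistent[OF B subgroup_inner_mapping_group]
    by (simp add: inner_mapping_group_generated)
  moreover obtain \<theta> where "\<theta> \<in> hom (M\<lparr>carrier := inner_mapping_group L\<rparr>) F"
    "\<And>t. t \<in> inner_gens \<Longrightarrow> \<theta> t = basis_word t"
    using ex_inner_hom by blast
  ultimately show ?thesis
    using B inner_basis_subset by (intro I.is_free_groupI[of inner_basis \<theta>])
      (auto simp: basis_word_basis)
qed

end

section \<open>Steiner loops with a length\<close>

locale graded_steiner_loop = steiner_loop +
  fixes len :: "'a \<Rightarrow> nat"
  assumes len_cases: "\<lbrakk>v \<in> carrier L - {\<one>}; w \<in> carrier L - {\<one>}; v \<noteq> w\<rbrakk> \<Longrightarrow>
      (len v < len (v \<otimes> w) \<and> len w < len (v \<otimes> w)) \<or>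
      (len w < len v \<and> len (v \<otimes> w) < len v) \<or>
      (len v < len w \<and> len (v \<otimes> w) < len w)"
    and len_unique: "\<lbrakk>a \<in> carrier L; b \<in> carrier L; c \<in> carrier L; d \<in> carrier L; a \<otimes> b = c \<otimes> d;
      len a < len (a \<otimes> b); len b < len (a \<otimes> b); len c < len (a \<otimes> b); len d < len (a \<otimes> b)\<rbrakk> \<Longrightarrow>
      {a, b} = {c, d}"
    and len_one: "len \<one> = 0"
begin

lemma len_mult_or_factor:
  assumes "y \<in> carrier L" "v \<in> carrier L" "v \<noteq> \<one>" "len v < len y"
  shows "len y < len (y \<otimes> v) \<or> len (y \<otimes> v) < len y"
proof -
  have "y \<noteq> \<one>" "y \<noteq> v" using assms(4) by (auto simp: len_one)
  then show ?thesis using len_cases[of y v] assms by auto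
qed

text \<open>If \<open>v\<close> shortened \<open>y\<close>, then
  \<open>y = (y \<otimes> v) \<otimes> v\<close> would be a second factorization into shorter
  elements, and \<open>v\<close> would have to be \<open>w\<close> or \<open>u\<close>.\<close>

lemma len_mult_mono:
  assumes y: "w \<in> carrier L" "u \<in> carrier L" "y = w \<otimes> u" "len w < len y" "len u < len y"
    and v: "v \<in> carrier L" "v \<noteq> \<one>" "len v < len y" "v \<noteq> w" "v \<noteq> u"
  shows "len y < len (y \<otimes> v)"
proof (rule ccontr)
  assume "\<not> len y < len (y \<otimes> v)"
  then have "len (y \<otimes> v) < len y" using len_mult_or_factor[of y v] y v by auto
  then have "{w, u} = {y \<otimes> v, v}" using y v by (intro len_unique) auto
  then show False using v by auto
qed

text \<open>The invariant is that the current element has the two shorter factors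
  \<open>hd vs\<close>, the letter applied last, and some \<open>w\<close> at least as long as
  \<open>y\<close>. The next letter differs from \<open>hd vs\<close> by \<open>distinct_adj\<close>
  and from \<open>w\<close> because it is shorter than \<open>y\<close>, so
  \<open>len_mult_mono\<close> applies again.\<close>

lemma len_foldr_translation:
  assumes "distinct_adj vs" "vs \<noteq> []" "set vs \<subseteq> carrier L - {\<one>}" "y \<in> carrier L"
    "\<And>v. v \<in> set vs \<Longrightarrow> len v < len y" "len y < len (y \<otimes> last vs)"
  shows "len y < len (foldr (\<lambda>v z. z \<otimes> v) vs y) \<and>
    (\<exists>w\<in>carrier L. foldr (\<lambda>v z. z \<otimes> v) vs y = w \<otimes> hd vs \<and> len y \<le> len w \<and>
      len w < len (foldr (\<lambda>v z. z \<otimes> v) vs y))"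
  using assms
proof (induction vs)
  case Nil
  then show ?case by simp
next
  case (Cons v vs)
  show ?case
  proof (cases "vs = []")
    case True
    then show ?thesis using Cons.prems by auto
  next
    case False
    define z where "z = foldr (\<lambda>v z. z \<otimes> v) vs y"
    have IH: "len y < len z \<and> (\<exists>w\<in>carrier L. z = w \<otimes> hd vs \<and> len y \<le> len w \<and> len w < len z)"
      unfolding z_def
      by (rule Cons.IH) (use Cons.prems False in \<open>auto simp: distinct_adj_Cons\<close>)
    then obtain w where w: "w \<in> carrier L" "z = w \<otimes> hd vs" "len y \<le> len w" "len w < len z"
      by blast
    have hd: "hd vs \<in> set vs" using False by simp
    have "len z < len (z \<otimes> v)"
    proof (rule len_mult_mono[of w "hd vs"])
      show "len (hd vs) < len z" "len v < len z" "v \<noteq> w"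
        using Cons.prems(5)[of "hd vs"] Cons.prems(5)[of v] hd IH w by auto
      show "v \<noteq> hd vs" using Cons.prems(1) False by (cases vs) auto
    qed (use w hd Cons.prems in auto)
    moreover have "z \<in> carrier L" using w hd Cons.prems by auto
    ultimately show ?thesis
      using IH by (auto simp: z_def[symmetric] intro!: bexI[of _ z])
  qed
qed

lemma foldr_translation_apply:
  assumes "set vs \<subseteq> carrier L" "y \<in> carrier L"
  shows "foldr (\<lambda>v k. R v \<otimes>\<^bsub>M\<^esub> k) vs \<one>\<^bsub>M\<^esub> \<in> carrier M \<and>
    foldr (\<lambda>v z. z \<otimes> v) vs y \<in> carrier L \<and>
    foldr (\<lambda>v k. R v \<otimes>\<^bsub>M\<^esub> k) vs \<one>\<^bsub>M\<^esub> y = foldr (\<lambda>v z. z \<otimes> v) vs y"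
  using assms
proof (induction vs)
  case Nil
  then show ?case by (simp add: mult_one_apply)
next
  case (Cons v vs)
  then show ?case by (simp add: mult_apply translation_closed translation_apply)
qed

text \<open>Every element has at most two factors, so one of three minimal elements lengthens it.\<close>

lemma ex_lengthening:
  assumes X: "x \<in> carrier L - {\<one>}" "y \<in> carrier L - {\<one>}" "z \<in> carrier L - {\<one>}"
    "len x = 0" "len y = 0" "len z = 0" "x \<noteq> y" "y \<noteq> z" "x \<noteq> z"
    and w: "w \<in> carrier L" "0 < len w"
  shows "\<exists>u\<in>{x, y, z}. len w < len (w \<otimes> u)"
proof (rule ccontr)
  assume "\<not> ?thesis"
  then have less: "len (w \<otimes> x) < len w" "len (w \<otimes> y) < len w" "len (w \<otimes> z) < len w"
    using len_mult_or_factor[of w x] len_mult_or_factor[of w y] len_mult_or_factor[of w z] X w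
    by auto
  \<comment> \<open>As \<open>x\<close> differs from \<open>y\<close> and \<open>z\<close>, both of
    these would have to be \<open>w \<otimes> x\<close>, contradicting
    \<open>y \<noteq> z\<close>.\<close>
  have "{w \<otimes> x, x} = {w \<otimes> y, y}" "{w \<otimes> x, x} = {w \<otimes> z, z}"
    using X w less by (intro len_unique; simp)+
  then show False using X by (auto simp: doubleton_eq_iff)
qed

lemma ex_len_ge:
  assumes X: "x \<in> carrier L - {\<one>}" "y \<in> carrier L - {\<one>}" "z \<in> carrier L - {\<one>}"
    "len x = 0" "len y = 0" "len z = 0" "x \<noteq> y" "y \<noteq> z" "x \<noteq> z"
  shows "\<exists>w\<in>carrier L. n < len w"
proof (induction n)
  case 0
  \<comment> \<open>The other two alternatives of \<open>len_cases\<close> would require a length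
    below zero.\<close>
  have "0 < len (x \<otimes> y)" using len_cases[of x y] X by auto
  then show ?case using X by auto
next
  case (Suc n)
  then obtain w where w: "w \<in> carrier L" "n < len w" by blast
  then obtain u where "u \<in> {x, y, z}" "len w < len (w \<otimes> u)"
    using ex_lengthening[OF X, of w] by auto
  then show ?case using w X by (auto intro!: bexI[of _ "w \<otimes> u"])
qed

text \<open>It suffices to find \<open>p\<close> that is longer than all letters and is lengthened
  by the letter acting first, \<open>last vs\<close>; the word then sends \<open>p\<close> to a
  longer element.\<close>

lemma translation_free_if_three:
  assumes X: "x \<in> carrier L - {\<one>}" "y \<in> carrier L - {\<one>}" "z \<in> carrier L - {\<one>}"
    "len x = 0" "len y = 0" "len z = 0" "x \<noteq> y" "y \<noteq> z" "x \<noteq> z"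
  shows "translation_free_steiner_loop L"
proof unfold_locales
  fix vs assume vs: "vs \<noteq> []" "set vs \<subseteq> carrier L - {\<one>}" "distinct_adj vs"
  define n where "n = Max (len ` set vs)"
  have n: "len v \<le> n" if "v \<in> set vs" for v using that by (simp add: n_def)
  have last: "last vs \<in> set vs" "last vs \<in> carrier L" "last vs \<noteq> \<one>"
    using vs last_in_set[OF vs(1)] by blast+
  obtain w where w: "w \<in> carrier L" "n < len w" using ex_len_ge[OF X] by blast
  then obtain u where u: "u \<in> {x, y, z}" "len w < len (w \<otimes> u)"
    using ex_lengthening[OF X, of w] by auto
  then have uL: "u \<in> carrier L" "len u = 0" using X by auto
  obtain p where p: "p \<in> carrier L" "n < len p" "len p < len (p \<otimes> last vs)"
  proof (cases "last vs = u")
    case False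
    \<comment> \<open>The shorter factors of \<open>w \<otimes> u\<close> are \<open>w\<close> and
      \<open>u\<close>; \<open>last vs\<close> is neither, being shorter than \<open>w\<close> and
      different from \<open>u\<close>.\<close>
    have "len (w \<otimes> u) < len (w \<otimes> u \<otimes> last vs)"
      by (rule len_mult_mono[of w u]) (use w u uL last False n[of "last vs"] in auto)
    then show thesis using that[of "w \<otimes> u"] w u uL by simp
  next
    case True
    \<comment> \<open>Here \<open>u\<close> itself would undo the last multiplication, so a
      different minimal element is inserted first; the factors then are \<open>w \<otimes> u\<close>
      and \<open>u'\<close>.\<close>
    obtain u' where u': "u' \<in> {x, y, z}" "u' \<noteq> u" using u X by blast
    then have u'L: "u' \<in> carrier L" "len u' = 0" "u' \<noteq> \<one>" using X by auto
    have longer: "len (w \<otimes> u) < len (w \<otimes> u \<otimes> u')"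
      by (rule len_mult_mono[of w u]) (use w u uL u' u'L in auto)
    have "len (w \<otimes> u \<otimes> u') < len (w \<otimes> u \<otimes> u' \<otimes> last vs)"
      by (rule len_mult_mono[of "w \<otimes> u" u'])
        (use w u uL u' u'L longer last True n[of "last vs"] in auto)
    then show thesis using that[of "w \<otimes> u \<otimes> u'"] w u uL u'L longer by simp
  qed
  have "len p < len (foldr (\<lambda>v z. z \<otimes> v) vs p)"
    using len_foldr_translation[OF vs(3,1,2) p(1) _ p(3)] n p(2) le_less_trans by blast
  moreover have "set vs \<subseteq> carrier L" using vs(2) by blast
  ultimately have "foldr (\<lambda>v k. R v \<otimes>\<^bsub>M\<^esub> k) vs \<one>\<^bsub>M\<^esub> p \<noteq> p"
    using foldr_translation_apply[of vs p] p(1) by fastforce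
  then show "foldr (\<lambda>v k. R v \<otimes>\<^bsub>M\<^esub> k) vs \<one>\<^bsub>M\<^esub> \<noteq> \<one>\<^bsub>M\<^esub>"
    using p(1) by (auto simp: mult_one_apply)
qed

end

section \<open>Normal forms in the free Steiner loop\<close>

primrec mults :: "'a loop_term \<Rightarrow> nat" where
  "mults LUnit = 0"
| "mults (LGen x) = 0"
| "mults (LMult s t) = Suc (mults s + mults t)"

text \<open>A representative of the unordered pair of \<open>s\<close> and \<open>t\<close>; which one is chosen is irrelevant.\<close>

definition node :: "'a loop_term \<Rightarrow> 'a loop_term \<Rightarrow> 'a loop_term" where
  "node s t = (SOME u. u \<in> {LMult s t, LMult t s})"

lemma node_commute: "node s t = node t s"
  by (simp add: node_def insert_commute)

lemma node_cases: "node s t = LMult s t \<or> node s t = LMult t s"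
proof -
  have "node s t \<in> {LMult s t, LMult t s}" unfolding node_def by (rule someI[of _ "LMult s t"]) simp
  then show ?thesis by simp
qed

lemma node_eq_iff: "node a b = node c d \<longleftrightarrow> {a, b} = {c, d}"
proof
  assume "node a b = node c d"
  then show "{a, b} = {c, d}"
    using node_cases[of a b] node_cases[of c d] by (auto simp: doubleton_eq_iff)
next
  assume "{a, b} = {c, d}"
  then show "node a b = node c d"
    using node_commute[of a b] by (metis doubleton_eq_iff)
qed

lemma node_neq [simp]: "node s t \<noteq> LUnit" "node s t \<noteq> LGen x" "LUnit \<noteq> node s t"
  using node_cases[of s t] by auto

lemma mults_node [simp]: "mults (node s t) = Suc (mults s + mults t)"
  using node_cases[of s t] by auto

lemma node_neq_left [simp]: "node s t \<noteq> s" "s \<noteq> node s t" "node t s \<noteq> s" "s \<noteq> node t s"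
  using mults_node[of s t] mults_node[of t s] by (metis less_add_Suc1 less_add_Suc2 less_irrefl)+

lemma node_left_cancel [simp]: "node s t = node s u \<longleftrightarrow> t = u"
  by (auto simp: node_eq_iff doubleton_eq_iff)

text \<open>The product of normal forms. The \<open>THE\<close> terms are well determined because a
  node and one of its factors determine the other factor.\<close>

definition red_mult :: "'a loop_term \<Rightarrow> 'a loop_term \<Rightarrow> 'a loop_term" where
  "red_mult s t =
     (if s = LUnit then t else if t = LUnit then s else if s = t then LUnit
      else if \<exists>u. s = node t u then THE u. s = node t u
      else if \<exists>u. t = node s u then THE u. t = node s u
      else node s t)"

lemma red_mult_simps [simp]:
  "red_mult LUnit t = t" "red_mult s LUnit = s" "red_mult s s = LUnit"
  "t \<noteq> LUnit \<Longrightarrow> red_mult (node t u) t = u"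
  by (auto simp: red_mult_def)

lemma red_mult_node_right [simp]:
  assumes "s \<noteq> LUnit"
  shows "red_mult s (node s u) = u"
proof -
  \<comment> \<open>This excludes the earlier branch of \<open>red_mult\<close>, in which the left
    argument is the node to be taken apart.\<close>
  have "s \<noteq> node (node s u) v" for v
  proof -
    have "mults s \<noteq> mults (node (node s u) v)" by simp
    then show ?thesis by metis
  qed
  then show ?thesis using assms by (auto simp: red_mult_def)
qed

lemma red_mult_node:
  "\<lbrakk>s \<noteq> LUnit; t \<noteq> LUnit; s \<noteq> t; \<And>u. s \<noteq> node t u; \<And>u. t \<noteq> node s u\<rbrakk> \<Longrightarrow> red_mult s t = node s t"
  by (auto simp: red_mult_def)

lemma red_mult_cases:
  obtains "s = LUnit" "red_mult s t = t" | "t = LUnit" "red_mult s t = s"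
  | "s = t" "red_mult s t = LUnit"
  | u where "s \<noteq> LUnit" "t \<noteq> LUnit" "s = node t u" "red_mult s t = u"
  | u where "s \<noteq> LUnit" "t \<noteq> LUnit" "t = node s u" "red_mult s t = u"
  | "s \<noteq> LUnit" "t \<noteq> LUnit" "s \<noteq> t" "\<And>u. s \<noteq> node t u" "\<And>u. t \<noteq> node s u"
    "red_mult s t = node s t"
proof -
  consider "s = LUnit" | "t = LUnit" | "s = t" | u where "s \<noteq> LUnit" "t \<noteq> LUnit" "s = node t u"
    | u where "s \<noteq> LUnit" "t \<noteq> LUnit" "t = node s u"
    | "s \<noteq> LUnit" "t \<noteq> LUnit" "s \<noteq> t" "\<And>u. s \<noteq> node t u" "\<And>u. t \<noteq> node s u"
    by blast
  then show thesis
  proof cases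
    case 1
    then show ?thesis using that(1) by simp
  next
    case 2
    then show ?thesis using that(2) by simp
  next
    case 3
    then show ?thesis using that(3) by simp
  next
    case (4 u)
    then show ?thesis using that(4)[of u] by simp
  next
    case (5 u)
    then show ?thesis using that(5)[of u] by simp
  next
    case 6
    then show ?thesis using that(6) red_mult_node[of s t] by blast
  qed
qed

lemma red_mult_commute: "red_mult s t = red_mult t s"
proof (cases rule: red_mult_cases[of s t])
  case 6
  then show ?thesis using red_mult_node[of t s] node_commute[of s t] by metis
qed simp_all

text \<open>The side conditions of \<open>reduced_node\<close> are those under which
  \<open>red_mult\<close> builds a new node.\<close>

inductive reduced :: "'a loop_term \<Rightarrow> bool" where
  reduced_LUnit: "reduced LUnit"
| reduced_LGen: "reduced (LGen x)"
| reduced_node: "\<lbrakk>reduced s; reduced t; s \<noteq> LUnit; t \<noteq> LUnit; s \<noteq> t;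
    \<And>u. s \<noteq> node t u; \<And>u. t \<noteq> node s u\<rbrakk> \<Longrightarrow> reduced (node s t)"

lemma reduced_nodeD:
  assumes "reduced (node s t)"
  shows "reduced s \<and> reduced t \<and> s \<noteq> LUnit \<and> t \<noteq> LUnit \<and> s \<noteq> t \<and>
    (\<forall>u. s \<noteq> node t u) \<and> (\<forall>u. t \<noteq> node s u)"
  using assms by (cases rule: reduced.cases) (auto simp: node_eq_iff doubleton_eq_iff)

lemma reduced_red_mult:
  assumes "reduced s" "reduced t"
  shows "reduced (red_mult s t)"
proof (cases rule: red_mult_cases[of s t])
  case (4 u)
  then show ?thesis using assms(1) reduced_nodeD[of t u] by simp
next
  case (5 u)
  then show ?thesis using assms(2) reduced_nodeD[of s u] by simp
next
  case 6
  then show ?thesis using assms reduced_node[of s t] by simp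
qed (use assms in \<open>simp_all add: reduced_LUnit\<close>)

text \<open>Reducedness enters when one argument is a node over the other: it ensures that the
  exposed factor is not \<open>LUnit\<close> and that multiplying it back restores the node.\<close>

lemma red_mult_cancel:
  assumes "reduced s" "reduced t"
  shows "red_mult s (red_mult s t) = t"
proof (cases rule: red_mult_cases[of s t])
  case (4 u)
  then have "u \<noteq> LUnit" using assms(1) reduced_nodeD[of t u] by simp
  then show ?thesis using 4 node_commute[of t u] by simp
next
  case (5 u)
  have "red_mult s u = node s u" using reduced_nodeD[of s u] assms(2) 5 by (intro red_mult_node) auto
  then show ?thesis using 5 by simp
qed simp_all

primrec nf :: "'a loop_term \<Rightarrow> 'a loop_term" where
  "nf LUnit = LUnit"
| "nf (LGen x) = LGen x"
| "nf (LMult s t) = red_mult (nf s) (nf t)"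

lemma reduced_nf: "reduced (nf t)"
  by (induction t) (simp_all add: reduced_LUnit reduced_LGen reduced_red_mult)

text \<open>On reduced terms \<open>red_mult\<close> satisfies the identities of Steiner loops, and
  all values of \<open>nf\<close> are reduced.\<close>

lemma steiner_eq_imp_nf_eq: "steiner_eq s t \<Longrightarrow> nf s = nf t"
  by (induction rule: steiner_eq.induct) (auto simp: red_mult_commute red_mult_cancel reduced_nf)

lemma steiner_eq_node: "steiner_eq (node s t) (LMult s t)"
  using node_cases[of s t] by (auto intro: se_refl se_comm)

text \<open>Each branch of \<open>red_mult\<close> is an instance of the identities. Hence a term
  equals its normal form in the free loop, and \<open>nf\<close> decides equality there.\<close>

lemma steiner_eq_red_mult: "steiner_eq (LMult s t) (red_mult s t)"
proof (cases rule: red_mult_cases[of s t])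
  case 1
  then show ?thesis by (simp add: se_unit)
next
  case 2
  then show ?thesis using se_trans[OF se_comm se_unit] by simp
next
  case 3
  then show ?thesis by (simp add: se_self)
next
  case (4 u)
  have "steiner_eq (LMult (node t u) t) (LMult t (LMult t u))"
    by (rule se_trans[OF se_comm se_prod[OF se_refl steiner_eq_node]])
  from se_trans[OF this se_cancel] show ?thesis using 4 by simp
next
  case (5 u)
  have "steiner_eq (LMult s (node s u)) u"
    by (rule se_trans[OF se_prod[OF se_refl steiner_eq_node] se_cancel])
  then show ?thesis using 5 by simp
next
  case 6
  then show ?thesis using se_sym[OF steiner_eq_node] by simp
qed

lemma steiner_eq_nf: "steiner_eq t (nf t)"
proof (induction t)
  case (LMult s t)
  from se_trans[OF se_prod[OF LMult] steiner_eq_red_mult] show ?case by simp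
qed (simp_all add: se_refl)

lemma steiner_eq_iff_nf_eq: "steiner_eq s t \<longleftrightarrow> nf s = nf t"
  using steiner_eq_imp_nf_eq steiner_eq_nf by (metis se_sym se_trans)

text \<open>A newly built node is longer than both arguments; otherwise one argument is a node, and
  the other argument and the product are its two shorter factors.\<close>

lemma mults_red_mult_cases:
  assumes "s \<noteq> LUnit" "t \<noteq> LUnit" "s \<noteq> t"
  shows "(mults s < mults (red_mult s t) \<and> mults t < mults (red_mult s t)) \<or>
      (mults t < mults s \<and> mults (red_mult s t) < mults s) \<or>
      (mults s < mults t \<and> mults (red_mult s t) < mults t)"
  using assms by (cases rule: red_mult_cases[of s t]) auto

text \<open>Only the last branch yields something longer than both arguments. Together with
  \<open>node_eq_iff\<close> this gives the uniqueness of shorter factors.\<close>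

lemma red_mult_eq_node:
  assumes "mults s < mults (red_mult s t)" "mults t < mults (red_mult s t)"
  shows "red_mult s t = node s t"
  using assms by (cases rule: red_mult_cases[of s t]) auto

text \<open>All members of a class have the same normal form, so the chosen representative does not
  affect the length.\<close>

definition class_len :: "'a loop_term set \<Rightarrow> nat" where
  "class_len U = mults (nf (SOME t. t \<in> U))"

lemma class_len:
  assumes "t \<in> loop_terms X"
  shows "class_len (steiner_class X t) = mults (nf t)"
proof -
  have "t \<in> steiner_class X t" using assms by (simp add: steiner_class_def se_refl)
  then have "(SOME u. u \<in> steiner_class X t) \<in> steiner_class X t" by (rule someI)
  then show ?thesis by (simp add: class_len_def steiner_class_def steiner_eq_iff_nf_eq)
qed

lemma graded_free_steiner_loop: "graded_steiner_loop (free_steiner_loop X) class_len"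
proof -
  let ?S = "free_steiner_loop X"
  interpret S: steiner_loop ?S by (rule steiner_loop_free_steiner_loop)
  have eq: "steiner_class X s = steiner_class X t \<longleftrightarrow> nf s = nf t"
    if "s \<in> loop_terms X" "t \<in> loop_terms X" for s t
    using that by (simp add: steiner_class_eq_iff steiner_eq_iff_nf_eq)
  show ?thesis
  proof unfold_locales
    fix v w assume vw: "v \<in> carrier ?S - {\<one>\<^bsub>?S\<^esub>}" "w \<in> carrier ?S - {\<one>\<^bsub>?S\<^esub>}" "v \<noteq> w"
    then obtain s t where st: "s \<in> loop_terms X" "t \<in> loop_terms X"
      "v = steiner_class X s" "w = steiner_class X t"
      by (auto simp: free_steiner_loop_carrier)
    then have "nf s \<noteq> LUnit" "nf t \<noteq> LUnit" "nf s \<noteq> nf t"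
      using vw by (simp_all add: free_steiner_loop_one eq)
    with st show "(class_len v < class_len (v \<otimes>\<^bsub>?S\<^esub> w) \<and> class_len w < class_len (v \<otimes>\<^bsub>?S\<^esub> w)) \<or>
      (class_len w < class_len v \<and> class_len (v \<otimes>\<^bsub>?S\<^esub> w) < class_len v) \<or>
      (class_len v < class_len w \<and> class_len (v \<otimes>\<^bsub>?S\<^esub> w) < class_len w)"
      using mults_red_mult_cases[of "nf s" "nf t"] by (simp add: free_steiner_loop_mult class_len)
  next
    fix a b c d
    assume carr: "a \<in> carrier ?S" "b \<in> carrier ?S" "c \<in> carrier ?S" "d \<in> carrier ?S"
      and ab: "a \<otimes>\<^bsub>?S\<^esub> b = c \<otimes>\<^bsub>?S\<^esub> d"
      and len: "class_len a < class_len (a \<otimes>\<^bsub>?S\<^esub> b)" "class_len b < class_len (a \<otimes>\<^bsub>?S\<^esub> b)"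
        "class_len c < class_len (a \<otimes>\<^bsub>?S\<^esub> b)" "class_len d < class_len (a \<otimes>\<^bsub>?S\<^esub> b)"
    obtain s t p q where st: "s \<in> loop_terms X" "t \<in> loop_terms X" "p \<in> loop_terms X" "q \<in> loop_terms X"
      "a = steiner_class X s" "b = steiner_class X t" "c = steiner_class X p" "d = steiner_class X q"
      using carr by (auto simp: free_steiner_loop_carrier)
    have m: "red_mult (nf s) (nf t) = red_mult (nf p) (nf q)"
      using ab st by (simp add: free_steiner_loop_mult eq)
    have "red_mult (nf s) (nf t) = node (nf s) (nf t)"
      by (rule red_mult_eq_node) (use len st in \<open>simp_all add: free_steiner_loop_mult class_len\<close>)
    moreover have "red_mult (nf p) (nf q) = node (nf p) (nf q)"
      by (rule red_mult_eq_node)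
        (use len[unfolded ab] st in \<open>simp_all add: free_steiner_loop_mult class_len\<close>)
    ultimately have "{nf s, nf t} = {nf p, nf q}" using m node_eq_iff by metis
    then show "{a, b} = {c, d}"
      using st by (simp add: doubleton_eq_iff eq)
  qed (simp add: free_steiner_loop_one class_len)
qed

section \<open>Free Steiner loops on few generators and the final assembly\<close>

lemma free_steiner_loop_subset:
  assumes "steiner_class X LUnit \<in> A" "\<And>x. x \<in> X \<Longrightarrow> steiner_class X (LGen x) \<in> A"
    and "\<And>U V. U \<in> A \<Longrightarrow> V \<in> A \<Longrightarrow> U \<otimes>\<^bsub>free_steiner_loop X\<^esub> V \<in> A"
  shows "carrier (free_steiner_loop X) \<subseteq> A"
proof -
  have "steiner_class X t \<in> A" if "t \<in> loop_terms X" for t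
    using that
  proof (induction t)
    case (LMult s t)
    then show ?case using assms(3)[of "steiner_class X s" "steiner_class X t"]
      by (simp add: free_steiner_loop_mult)
  qed (use assms in simp_all)
  then show ?thesis by (auto simp: free_steiner_loop_carrier)
qed

lemma is_free_group_trivial:
  assumes "group G" "carrier G = {\<one>\<^bsub>G\<^esub>}"
  shows "is_free_group G"
proof -
  interpret group G by fact
  interpret F: group "free_group {}" by (rule group_free_group)
  show ?thesis
    by (rule is_free_groupI[of "{}" "\<lambda>_. \<one>\<^bsub>free_group {}\<^esub>"]) (auto simp: assms hom_def generate.one)
qed

lemma translation_free_free_steiner_loop:
  assumes "finite X" "card X \<noteq> 2"
  shows "translation_free_steiner_loop (free_steiner_loop X)"
proof -
  let ?S = "free_steiner_loop X" and ?g = "\<lambda>x. steiner_class X (LGen x)"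
  interpret S: graded_steiner_loop ?S class_len by (rule graded_free_steiner_loop)
  show ?thesis
  proof (cases "card X \<ge> 3")
    case True
    then obtain Y where "Y \<subseteq> X" "card Y = 3" using obtain_subset_with_card_n by metis
    then obtain x y z where xyz: "x \<in> X" "y \<in> X" "z \<in> X" "x \<noteq> y" "y \<noteq> z" "x \<noteq> z"
      by (auto simp: card_3_iff)
    have gen: "?g u \<in> carrier ?S - {\<one>\<^bsub>?S\<^esub>}" "class_len (?g u) = 0" if "u \<in> X" for u
      using that by (auto simp: free_steiner_loop_carrier free_steiner_loop_one class_len
          steiner_class_eq_iff steiner_eq_iff_nf_eq)
    have "?g u \<noteq> ?g v" if "u \<in> X" "v \<in> X" "u \<noteq> v" for u v
      using that by (simp add: steiner_class_eq_iff steiner_eq_iff_nf_eq)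
    then show ?thesis
      using gen xyz by (intro S.translation_free_if_three[of "?g x" "?g y" "?g z"]) auto
  next
    case False
    with assms have "card X = 0 \<or> card X = 1" by linarith
    then obtain x where "X \<subseteq> {x}" using assms(1) by (auto simp: card_1_singleton_iff)
    then have gen: "?g y \<in> carrier ?S" "?g y = ?g x" if "y \<in> X" for y
      using that by (auto simp: free_steiner_loop_carrier)
    have small: "carrier ?S \<subseteq> {\<one>\<^bsub>?S\<^esub>} \<union> ?g ` X"
      by (rule free_steiner_loop_subset)
        (use gen in \<open>auto simp: free_steiner_loop_one[symmetric]\<close>)
    show ?thesis
    proof unfold_locales
      fix vs assume vs: "vs \<noteq> []" "set vs \<subseteq> carrier ?S - {\<one>\<^bsub>?S\<^esub>}" "distinct_adj vs"
      then obtain v ws where v: "vs = v # ws" by (cases vs) auto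
      have all: "w = ?g x" if "w \<in> set vs" for w using vs(2) small gen that by blast
      \<comment> \<open>There is at most one nontrivial element, so a second letter would repeat the
        first.\<close>
      have "ws = []"
        using vs(3) v all by (cases ws) auto
      then show "foldr (\<lambda>v k. S.R v \<otimes>\<^bsub>S.M\<^esub> k) vs \<one>\<^bsub>S.M\<^esub> \<noteq> \<one>\<^bsub>S.M\<^esub>"
        using v vs(2) by (simp add: S.translation_closed S.translation_eq_one_iff)
    qed
  qed
qed

text \<open>On two generators the free Steiner loop is the Klein four-group.\<close>

lemma inner_gen_two_generators:
  assumes "v \<in> carrier (free_steiner_loop {a, b})" "w \<in> carrier (free_steiner_loop {a, b})"
  shows "loop.inner_gen (free_steiner_loop {a, b}) v w = \<one>\<^bsub>mult_group (free_steiner_loop {a, b})\<^esub>"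
proof -
  let ?X = "{a, b}"
  let ?S = "free_steiner_loop ?X"
  interpret S: steiner_loop ?S by (rule steiner_loop_free_steiner_loop)
  define x y where "x = steiner_class ?X (LGen a)" and "y = steiner_class ?X (LGen b)"
  have xy: "x \<in> carrier ?S" "y \<in> carrier ?S"
    by (auto simp: x_def y_def free_steiner_loop_carrier)
  let ?K = "{\<one>\<^bsub>?S\<^esub>, x, y, x \<otimes>\<^bsub>?S\<^esub> y}"
  have yx: "y \<otimes>\<^bsub>?S\<^esub> x = x \<otimes>\<^bsub>?S\<^esub> y" using xy by (rule S.m_comm[rotated])
  have K: "carrier ?S \<subseteq> ?K"
    by (rule free_steiner_loop_subset)
      (auto simp: free_steiner_loop_one[symmetric] x_def[symmetric] y_def[symmetric] xy yx)
  have "((u \<otimes>\<^bsub>?S\<^esub> (v \<otimes>\<^bsub>?S\<^esub> w)) \<otimes>\<^bsub>?S\<^esub> w) \<otimes>\<^bsub>?S\<^esub> v = u" if "u \<in> carrier ?S" for u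
  proof -
    have "u \<in> ?K" "v \<in> ?K" "w \<in> ?K" using that assms K by blast+
    then show ?thesis by (elim insertE; simp add: xy yx)
  qed
  then show ?thesis
    using assms by (intro S.mult_eqI) (simp_all add: S.inner_gen_closed S.inner_gen_apply S.mult_one_apply)
qed

text \<open>The free product is claimed for \<open>card X \<noteq> 2\<close> because on two
  generators \<open>x\<close> and \<open>y\<close> the loop is the Klein four-group, where the
  product of the translations by \<open>x\<close>, \<open>y\<close> and \<open>x \<otimes> y\<close>
  is trivial. The displayed generators of the inner mapping group include the identity and come in
  inverse pairs, so they are claimed to generate it, and freeness is claimed of the group.\<close>

theorem proposition2:
  fixes X :: "'a::linorder set"
    and S :: "'a loop_term set monoid"
    and G :: "('a loop_term set \<Rightarrow> 'a loop_term set) monoid"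
    and R :: "'a loop_term set \<Rightarrow> 'a loop_term set \<Rightarrow> 'a loop_term set"
    and C :: "'a loop_term set \<Rightarrow> ('a loop_term set \<Rightarrow> 'a loop_term set) set"
  assumes "finite X"
    and "S = free_steiner_loop X"
    and "G = mult_group S"
    and "R = right_translation S"
    and "C = (\<lambda>v. generate G {R v})"
  shows
    "((\<forall>v \<in> carrier S - {\<one>\<^bsub>S\<^esub>}.
         cyclic_group (G\<lparr>carrier := C v\<rparr>) \<and> order (G\<lparr>carrier := C v\<rparr>) = 2) \<and>
      (card X \<noteq> 2 \<longrightarrow> is_free_product_of G (carrier S - {\<one>\<^bsub>S\<^esub>}) C)) \<and>
     (group_action G (carrier S) (\<lambda>g. g) \<and>
      carrier G = {R v | v. v \<in> carrier S} <#>\<^bsub>G\<^esub> inner_mapping_group S \<and>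
      subgroup (inner_mapping_group S) G \<and>
      is_free_group (G\<lparr>carrier := inner_mapping_group S\<rparr>) \<and>
      inner_mapping_group S =
        generate G {R v \<otimes>\<^bsub>G\<^esub> R w \<otimes>\<^bsub>G\<^esub> R (v \<otimes>\<^bsub>S\<^esub> w) | v w. v \<in> carrier S \<and> w \<in> carrier S})"
proof -
  interpret S: steiner_loop S
    unfolding assms(2) by (rule steiner_loop_free_steiner_loop)
  have free_product: "is_free_product_of S.M (carrier S - {\<one>\<^bsub>S\<^esub>}) (\<lambda>v. generate S.M {S.R v})"
    and free: "is_free_group (S.M\<lparr>carrier := inner_mapping_group S\<rparr>)" if "card X \<noteq> 2"
  proof -
    interpret translation_free_steiner_loop S
      unfolding assms(2) by (rule translation_free_free_steiner_loop[OF assms(1) that])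
    show "is_free_product_of S.M (carrier S - {\<one>\<^bsub>S\<^esub>}) (\<lambda>v. generate S.M {S.R v})"
      by (rule is_free_product_mult_group)
    show "is_free_group (S.M\<lparr>carrier := inner_mapping_group S\<rparr>)"
      by (rule is_free_group_inner_mapping_group)
  qed
  \<comment> \<open>All generators of the inner mapping group are trivial here, so it is free on the
    empty set.\<close>
  moreover have "is_free_group (S.M\<lparr>carrier := inner_mapping_group S\<rparr>)" if two: "card X = 2"
  proof -
    obtain a b where X: "X = {a, b}" using two by (auto simp: card_2_iff)
    have "S.inner_gen v w = \<one>\<^bsub>S.M\<^esub>" if "v \<in> carrier S" "w \<in> carrier S" for v w
      using inner_gen_two_generators that unfolding assms(2) X .
    then have "S.inner_gens \<subseteq> {\<one>\<^bsub>S.M\<^esub>}"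
      by (auto simp: S.inner_gens_def)
    then have "inner_mapping_group S \<subseteq> {\<one>\<^bsub>S.M\<^esub>}"
      unfolding S.inner_mapping_group_generated
      by (intro S.mult.generate_subgroup_incl S.mult.triv_subgroup)
    moreover note S.subgroup_inner_mapping_group
    ultimately show ?thesis
      using subgroup.one_closed by (intro is_free_group_trivial S.mult.subgroup_imp_group) auto
  qed
  moreover have "S.inner_gens =
      {S.R v \<otimes>\<^bsub>S.M\<^esub> S.R w \<otimes>\<^bsub>S.M\<^esub> S.R (v \<otimes>\<^bsub>S\<^esub> w) | v w. v \<in> carrier S \<and> w \<in> carrier S}"
    by (simp add: S.inner_gens_def S.inner_gen_def)
  ultimately show ?thesis
    unfolding assms(3-5)
    using S.translation_subgroup_order_two S.group_action_mult S.mult_group_factorization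
      S.subgroup_inner_mapping_group S.inner_mapping_group_generated
    by (intro conjI) auto
qed

end
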